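(* Let $R_0>0$ and let $(u_0,u_1)\in H^1(\mathbb{R})\times L^2(\mathbb{R})$ with $\operatorname{supp}(u_0,u_1)\subset[-R_0,R_0]$. Let $K:\mathbb{R}\to\mathbb{R}$ be admissible, and let $u$ denote the global solution to $$-\partial_t^2u+\partial_x^2u=K(x)u^3,\qquad (u,\partial_tu)|_{t=0}=(u_0,u_1).$$ Then for any $R\ge1$, $$\lim_{t\to\infty}\|u(t)\|_{L_x^\infty([-R,R])}=0.$$
   Context: All functions are real-valued; $t$ is time and $x\in\mathbb{R}$ is the one-dimensional space variable. Admissible: $K:\mathbb{R}\to\mathbb{R}$ is called admissible if $K$ is smooth, nonnegative, compactly supported in $[-1,1]$, and satisfies (i) $K(0)>0$ and (ii) $xK'(x)\le 0$ for all $x\in\mathbb{R}$. Global solution: for $(u_0,u_1)\in H^1\times L^2$, the solution is the unique function $u\in C(\mathbb{R};H^1)\cap C^1(\mathbb{R};L^2)$ satisfying $$u(t,x)=u_L(t,x)-\tfrac12\int_0^t\int_{x-(t-s)}^{x+(t-s)}K(y)u(s,y)^3\,dy\,ds,$$ where $u_L(t,x)=\tfrac12(u_0(x+t)+u_0(x-t))+\tfrac12\int_{x-t}^{x+t}u_1(s)\,ds$ is the solution of the linear wave equation with the same data. *)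

theory Defs
  imports "HOL-Analysis.Analysis" "HOL-Probability.Essential_Supremum"
begin

text \<open>
  Elements of Lebesgue and Sobolev spaces on the line are represented by Borel functions
  \<open>real \<Rightarrow> real\<close>. Every notion below is invariant under changes on Lebesgue null sets, and
  identities between such functions are required almost everywhere.
\<close>

definition L2 :: "(real \<Rightarrow> real) set" where
  "L2 = {f \<in> borel_measurable borel. integrable lborel (\<lambda>x. (f x)\<^sup>2)}"

definition L2_norm :: "(real \<Rightarrow> real) \<Rightarrow> real" where
  "L2_norm f = sqrt (LBINT x. (f x)\<^sup>2)"

definition smooth :: "(real \<Rightarrow> real) \<Rightarrow> bool" where
  "smooth f \<longleftrightarrow> (\<forall>n x. (deriv ^^ n) f differentiable (at x))"

definition supp :: "(real \<Rightarrow> 'a::zero) \<Rightarrow> real set" where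
  "supp f = closure {x. f x \<noteq> 0}"

definition test_function :: "(real \<Rightarrow> real) \<Rightarrow> bool" where
  "test_function \<phi> \<longleftrightarrow> smooth \<phi> \<and> compact (supp \<phi>)"

definition weak_derivative :: "(real \<Rightarrow> real) \<Rightarrow> (real \<Rightarrow> real) \<Rightarrow> bool" where
  "weak_derivative f g \<longleftrightarrow>
    (\<forall>\<phi>. test_function \<phi> \<longrightarrow> (LBINT x. f x * deriv \<phi> x) = - (LBINT x. g x * \<phi> x))"

definition H1 :: "(real \<Rightarrow> real) set" where
  "H1 = {f \<in> L2. \<exists>g\<in>L2. weak_derivative f g}"

text \<open>The weak derivative is unique almost everywhere, so the choice below is immaterial.\<close>

definition H1_norm :: "(real \<Rightarrow> real) \<Rightarrow> real" where
  "H1_norm f =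
    sqrt ((L2_norm f)\<^sup>2 + (L2_norm (SOME g. g \<in> L2 \<and> weak_derivative f g))\<^sup>2)"

text \<open>The support of an almost-everywhere class (the distributional support): the complement of
  the largest open set on which it vanishes.\<close>

definition ess_supp :: "(real \<Rightarrow> 'a::zero) \<Rightarrow> real set" where
  "ess_supp f = - \<Union>{U. open U \<and> (AE x in lborel. x \<in> U \<longrightarrow> f x = 0)}"

definition Linf_norm :: "real set \<Rightarrow> (real \<Rightarrow> real) \<Rightarrow> ennreal" where
  "Linf_norm S f = esssup (restrict_space lborel S) (\<lambda>x. ennreal \<bar>f x\<bar>)"

definition continuous_H1 :: "(real \<Rightarrow> real \<Rightarrow> real) \<Rightarrow> bool" where
  "continuous_H1 u \<longleftrightarrow> (\<forall>t. u t \<in> H1) \<and>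
    (\<forall>t. ((\<lambda>s. H1_norm (\<lambda>x. u s x - u t x)) \<longlongrightarrow> 0) (at t))"

definition continuous_L2 :: "(real \<Rightarrow> real \<Rightarrow> real) \<Rightarrow> bool" where
  "continuous_L2 u \<longleftrightarrow> (\<forall>t. u t \<in> L2) \<and>
    (\<forall>t. ((\<lambda>s. L2_norm (\<lambda>x. u s x - u t x)) \<longlongrightarrow> 0) (at t))"

definition C1_L2 :: "(real \<Rightarrow> real \<Rightarrow> real) \<Rightarrow> bool" where
  "C1_L2 u \<longleftrightarrow> continuous_L2 u \<and>
    (\<exists>v. continuous_L2 v \<and>
      (\<forall>t. ((\<lambda>h. L2_norm (\<lambda>x. (u (t + h) x - u t x) / h - v t x)) \<longlongrightarrow> 0) (at 0)))"

definition admissible :: "(real \<Rightarrow> real) \<Rightarrow> bool" where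
  "admissible K \<longleftrightarrow> smooth K \<and> (\<forall>x. 0 \<le> K x) \<and> supp K \<subseteq> {-1..1} \<and>
    0 < K 0 \<and> (\<forall>x. x * deriv K x \<le> 0)"

text \<open>The interval integrals below are oriented, as is needed for negative times.\<close>

definition linear_wave :: "(real \<Rightarrow> real) \<Rightarrow> (real \<Rightarrow> real) \<Rightarrow> real \<Rightarrow> real \<Rightarrow> real" where
  "linear_wave u0 u1 t x =
    (u0 (x + t) + u0 (x - t)) / 2 + (LBINT s=ereal (x - t)..ereal (x + t). u1 s) / 2"

definition global_solution ::
  "(real \<Rightarrow> real) \<Rightarrow> (real \<Rightarrow> real) \<Rightarrow> (real \<Rightarrow> real) \<Rightarrow> (real \<Rightarrow> real \<Rightarrow> real) \<Rightarrow> bool" where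
  "global_solution K u0 u1 u \<longleftrightarrow> continuous_H1 u \<and> C1_L2 u \<and>
    (\<forall>t. AE x in lborel. u t x = linear_wave u0 u1 t x -
      (LBINT s=ereal 0..ereal t.
        (LBINT y=ereal (x - (t - s))..ereal (x + (t - s)). K y * u s y ^ 3)) / 2)"

end

theory Submission
  imports Defs
begin

text \<open>
  Outside \<open>[-1, 1]\<close> the equation is linear, and after the data have left, at times
  \<open>t > R0 + 1\<close>, every wave crosses the points \<open>1\<close> and \<open>-1\<close> outwards only. The strip
  \<open>[-1, 1]\<close> is therefore a system that loses energy through its boundary, and a Morawetz estimate
  shows that it loses all of it.
  
  Write \<open>p = u\<^sub>t + u\<^sub>x\<close>, \<open>q = u\<^sub>t - u\<^sub>x\<close> and \<open>F = K u\<^sup>3\<close>. Then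
  \<open>p\<close> vanishes for \<open>x \<ge> 1\<close> and \<open>q\<close> vanishes for \<open>x \<le> -1\<close>. With all integrals over
  \<open>[-1, 1]\<close>, the quantity \<open>E = \<integral> p\<^sup>2 + q\<^sup>2 + K u\<^sup>4\<close> satisfies
  \<open>E' = - p(-1)\<^sup>2 - q(1)\<^sup>2\<close> (\<open>deriv_energy\<close>). For
  \<open>M = \<integral> x (p\<^sup>2 - q\<^sup>2) + 3/4 \<integral> u (p + q) + 3/4 (u(1)\<^sup>2 + u(-1)\<^sup>2)\<close> the assumption
  \<open>x K' \<le> 0\<close> gives \<open>(M + E)' \<le> - E / 4\<close> (\<open>deriv_morawetz\<close>). Since \<open>E\<close> is nonincreasing
  and \<open>K(0) > 0\<close> makes \<open>E\<close> control the supremum of \<open>|u|\<close> over \<open>[-1, 1]\<close>, the functional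
  \<open>M + E\<close> is bounded below, so \<open>E\<close> is \<open>O(1/t)\<close> and \<open>u\<close> tends to \<open>0\<close> uniformly on
  \<open>[-1, 1]\<close>. For \<open>|x| \<ge> 1\<close> the solution is an outgoing wave, that is, the value at
  \<open>1\<close> or \<open>-1\<close> at an earlier time (\<open>v_outgoing_right\<close>, \<open>v_outgoing_left\<close>).
  
  All identities are derived from the integral equation for \<open>v = c - 1/2 \<integral>\<integral> F\<close>, in which \<open>c\<close> is the
  value of the linear wave after the data have passed. As \<open>F\<close> is only known to be continuous, the
  energy densities are differentiated along characteristics only (\<open>oint_transport\<close>), where
  \<open>p\<close>, \<open>q\<close> and \<open>v\<close> are differentiable; no second derivatives are needed.
  
  That \<open>F\<close> is continuous in \<open>(t, x)\<close> follows from \<open>u \<in> C(\<real>; H\<^sup>1)\<close> and the one-dimensional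
  Sobolev embedding (\<open>H1_path_representative\<close>). The latter rests on the fact that a function
  with weak derivative \<open>g\<close> is almost everywhere a primitive of \<open>g\<close>
  (\<open>weak_derivative_primitive\<close>). The coefficient \<open>K\<close> itself, being smooth, nonnegative, nonzero
  and compactly supported, is the bump function from which the test functions are built.
\<close>

section \<open>Oriented integrals of continuous functions\<close>

text \<open>
  The oriented integral of \<open>f\<close> from \<open>a\<close> to \<open>b\<close>. Pulling it back to the fixed interval
  \<open>[0, 1]\<close> makes it depend continuously on parameters and endpoints without a case distinction on
  the order of \<open>a\<close> and \<open>b\<close>; it is used for continuous integrands only.
\<close>

definition oint :: "real \<Rightarrow> real \<Rightarrow> (real \<Rightarrow> real) \<Rightarrow> real" where
  "oint a b f = (b - a) * integral {0..1} (\<lambda>r. f (a + r * (b - a)))"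

lemma continuous_on_comp2:
  assumes "continuous_on UNIV (\<lambda>(x, y). f x y)" "continuous_on A h" "continuous_on A k"
  shows "continuous_on A (\<lambda>z. f (h z) (k z))"
  using continuous_on_compose2[OF assms(1) continuous_on_Pair[OF assms(2,3)]] by simp

lemma oint_FTC_on:
  assumes "\<And>x. x \<in> {l..u} \<Longrightarrow> (\<Phi> has_vector_derivative f x) (at x within {l..u})"
    and "a \<in> {l..u}" "b \<in> {l..u}"
  shows "oint a b f = \<Phi> b - \<Phi> a"
proof -
  have mem: "a + r * (b - a) \<in> {l..u}" if "r \<in> {0..1}" for r
  proof -
    have "a + r * (b - a) = (1 - r) *\<^sub>R a + r *\<^sub>R b" by (simp add: algebra_simps)
    also have "\<dots> \<in> {l..u}" using assms(2,3) that
      by (intro convexD) auto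
    finally show ?thesis .
  qed
  have "((\<lambda>r. (b - a) *\<^sub>R f (a + r * (b - a))) has_integral
      \<Phi> (a + 1 * (b - a)) - \<Phi> (a + 0 * (b - a))) {0..1}"
  proof (rule fundamental_theorem_of_calculus)
    fix r :: real assume r: "r \<in> {0..1}"
    have 1: "((\<lambda>r. a + r * (b - a)) has_vector_derivative (b - a)) (at r within {0..1})"
      by (auto intro!: derivative_eq_intros)
    have 2: "(\<Phi> has_vector_derivative f (a + r * (b - a)))
        (at (a + r * (b - a)) within (\<lambda>r. a + r * (b - a)) ` {0..1})"
      by (rule has_vector_derivative_within_subset[OF assms(1)[OF mem[OF r]]]) (use mem in auto)
    show "((\<lambda>r. \<Phi> (a + r * (b - a))) has_vector_derivative (b - a) *\<^sub>R f (a + r * (b - a)))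
        (at r within {0..1})"
      using vector_diff_chain_within[OF 1 2] by (simp add: o_def)
  qed simp
  then have "integral {0..1} (\<lambda>r. (b - a) *\<^sub>R f (a + r * (b - a))) = \<Phi> b - \<Phi> a"
    by (auto dest!: integral_unique)
  then show ?thesis
    by (simp add: oint_def)
qed

lemma oint_FTC:
  assumes "\<And>x. (\<Phi> has_real_derivative f x) (at x)"
  shows "oint a b f = \<Phi> b - \<Phi> a"
  using oint_FTC_on[of "min a b" "max a b" \<Phi> f a b] assms
  by (auto simp: has_real_derivative_iff_has_vector_derivative
      intro: has_vector_derivative_at_within)

lemma oint_deriv:
  assumes "continuous_on UNIV f"
  shows "((\<lambda>x. oint a x f) has_real_derivative f x) (at x)"
proof -
  define l u where "l = min a x - 1" and "u = max a x + 1"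
  have "continuous_on {l..u} f" by (rule continuous_on_subset[OF assms]) simp
  then obtain \<Phi> where \<Phi>: "\<And>x. x \<in> {l..u} \<Longrightarrow> (\<Phi> has_vector_derivative f x) (at x within {l..u})"
    using antiderivative_continuous by metis
  have x: "x \<in> {l<..<u}" and a: "a \<in> {l..u}"
    unfolding l_def u_def greaterThanLessThan_iff atLeastAtMost_iff by linarith+
  have "(\<Phi> has_vector_derivative f x) (at x within {l<..<u})"
    by (rule has_vector_derivative_within_subset[OF \<Phi>]) (use x in auto)
  then have "(\<Phi> has_real_derivative f x) (at x)"
    using at_within_open[OF x open_greaterThanLessThan]
    by (simp add: has_real_derivative_iff_has_vector_derivative)
  then have "((\<lambda>x. \<Phi> x - \<Phi> a) has_real_derivative f x) (at x)"
    using DERIV_diff[OF _ DERIV_const] by fastforce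
  then show ?thesis
  proof (rule has_field_derivative_transform_within_open[of _ _ _ "{l<..<u}"])
    fix y assume "y \<in> {l<..<u}"
    then show "\<Phi> y - \<Phi> a = oint a y f"
      using oint_FTC_on[OF \<Phi> a, of y] by auto
  qed (use x in auto)
qed

lemma oint_split:
  assumes "continuous_on UNIV f"
  shows "oint a b f = oint c b f - oint c a f"
  by (rule oint_FTC) (rule oint_deriv[OF assms])

lemma oint_refl [simp]: "oint a a f = 0"
  by (simp add: oint_def)

lemma oint_shift: "oint a b (\<lambda>x. f (x + d)) = oint (a + d) (b + d) f"
  by (simp add: oint_def algebra_simps)

lemma oint_eq_integral:
  assumes "continuous_on {a..b} f" "a \<le> b"
  shows "oint a b f = integral {a..b} f"
proof -
  obtain \<Phi> where \<Phi>: "\<And>x. x \<in> {a..b} \<Longrightarrow> (\<Phi> has_vector_derivative f x) (at x within {a..b})"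
    using antiderivative_continuous[OF assms(1)] by metis
  have "(f has_integral \<Phi> b - \<Phi> a) {a..b}"
    by (rule fundamental_theorem_of_calculus) (use \<Phi> assms in auto)
  with oint_FTC_on[OF \<Phi>, of a b] assms show ?thesis
    by (simp add: integral_unique)
qed

lemma oint_integrable:
  assumes "continuous_on UNIV (f :: real \<Rightarrow> real)"
  shows "(\<lambda>r. f (a + r * (b - a))) integrable_on {0..1}"
  by (rule integrable_continuous_interval, rule continuous_on_compose2[OF assms])
    (intro continuous_intros, simp)

lemma oint_add:
  assumes "continuous_on UNIV f" "continuous_on UNIV g"
  shows "oint a b (\<lambda>x. f x + g x) = oint a b f + oint a b g"
  unfolding oint_def
  by (subst Henstock_Kurzweil_Integration.integral_add)
    (intro oint_integrable assms | simp add: distrib_left)+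

lemma oint_cmult: "oint a b (\<lambda>x. c * f x) = c * oint a b f"
  by (simp add: oint_def)

lemma oint_uminus: "oint a b (\<lambda>x. - f x) = - oint a b f"
  using oint_cmult[of a b "-1" f] by simp

lemma oint_diff:
  assumes "continuous_on UNIV f" "continuous_on UNIV g"
  shows "oint a b (\<lambda>x. f x - g x) = oint a b f - oint a b g"
  using oint_add[of f "\<lambda>x. - g x" a b] assms
  by (simp add: oint_uminus continuous_on_minus)

lemma oint_const: "oint a b (\<lambda>_. c) = c * (b - a)"
  by (simp add: oint_def)

lemma oint_mono:
  assumes "continuous_on UNIV f" "continuous_on UNIV g" "a \<le> b"
    and "\<And>x. x \<in> {a..b} \<Longrightarrow> f x \<le> g x"
  shows "oint a b f \<le> oint a b g"
proof -
  have "f (a + r * (b - a)) \<le> g (a + r * (b - a))" if "r \<in> {0..1}" for r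
  proof (rule assms(4))
    have "r * (b - a) \<le> 1 * (b - a)" using that assms(3) by (intro mult_right_mono) auto
    then show "a + r * (b - a) \<in> {a..b}" using that assms(3) by auto
  qed
  then show ?thesis
    unfolding oint_def using assms
    by (intro mult_left_mono integral_le oint_integrable) auto
qed

lemma oint_nonneg:
  assumes "continuous_on UNIV f" "a \<le> b" "\<And>x. x \<in> {a..b} \<Longrightarrow> 0 \<le> f x"
  shows "0 \<le> oint a b f"
  using oint_mono[of "\<lambda>_. 0" f a b] assms by (simp add: oint_const)

lemma oint_cong:
  assumes "a \<le> b" "\<And>x. x \<in> {a..b} \<Longrightarrow> f x = g x"
  shows "oint a b f = oint a b g"
proof -
  have "f (a + r * (b - a)) = g (a + r * (b - a))" if "r \<in> {0..1}" for r
  proof (rule assms(2))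
    have "r * (b - a) \<le> 1 * (b - a)" using that assms(1) by (intro mult_right_mono) auto
    then show "a + r * (b - a) \<in> {a..b}" using that assms(1) by auto
  qed
  then have "integral {0..1} (\<lambda>r. f (a + r * (b - a))) = integral {0..1} (\<lambda>r. g (a + r * (b - a)))"
    by (intro Henstock_Kurzweil_Integration.integral_cong) auto
  then show ?thesis by (simp add: oint_def)
qed

lemma continuous_on_oint:
  fixes f :: "'a::topological_space \<Rightarrow> real \<Rightarrow> real"
  assumes "continuous_on UNIV (\<lambda>(z, x). f z x)"
    and "continuous_on UNIV a" "continuous_on UNIV b"
  shows "continuous_on UNIV (\<lambda>z. oint (a z) (b z) (f z))"
proof -
  have a: "continuous_on X (\<lambda>x. a (h x))" and b: "continuous_on X (\<lambda>x. b (h x))"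
    if "continuous_on X h" for X :: "('a \<times> real) set" and h
    using continuous_on_compose2[OF assms(2) that] continuous_on_compose2[OF assms(3) that] by simp_all
  have "continuous_on (UNIV \<times> cbox 0 1) (\<lambda>(z, r). f z (a z + r * (b z - a z)))"
    unfolding split_beta
    by (rule continuous_on_comp2[OF assms(1)]) (rule continuous_intros a b | simp)+
  then have "continuous_on UNIV (\<lambda>z. integral (cbox 0 1) (\<lambda>r. f z (a z + r * (b z - a z))))"
    by (rule integral_continuous_on_param)
  then show ?thesis
    unfolding oint_def by (intro continuous_intros assms) simp
qed

lemma oint_leibniz_upper:
  assumes f: "continuous_on UNIV (\<lambda>(t, x). f t x)"
    and f': "continuous_on UNIV (\<lambda>(t, x). f' t x)"
    and deriv: "\<And>t x. ((\<lambda>t. f t x) has_real_derivative f' t x) (at t)"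
    and b: "(b has_real_derivative b') (at t)"
  shows "((\<lambda>t. oint c (b t) (f t)) has_real_derivative oint c (b t) (f' t) + b' * f t (b t)) (at t)"
proof -
  have fc: "continuous_on UNIV (f t)" for t
    by (intro continuous_on_comp2[OF f] continuous_intros)
  have 1: "((\<lambda>t. oint c y (f t)) has_real_derivative oint c y (f' t)) (at t)" for y t
  proof -
    have "((\<lambda>t. integral (cbox 0 1) (\<lambda>r. f t (c + r * (y - c)))) has_real_derivative
        integral (cbox 0 1) (\<lambda>r. f' t (c + r * (y - c)))) (at t within UNIV)"
    proof (rule leibniz_rule_field_derivative)
      show "continuous_on (UNIV \<times> cbox 0 1) (\<lambda>(t, r). f' t (c + r * (y - c)))"
        unfolding split_beta by (intro continuous_on_comp2[OF f'] continuous_intros)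
    qed (use deriv oint_integrable[OF fc] in auto)
    then show ?thesis
      unfolding oint_def using DERIV_cmult by fastforce
  qed
  have 2: "((\<lambda>(t, y). oint c y (f t)) has_derivative
      (\<lambda>(s, y). oint c (b t) (f' t) * s + blinfun_scaleR_left (f t (b t)) y)) (at (t, b t) within UNIV \<times> UNIV)"
  proof (rule has_derivative_partialsI[where fy = "\<lambda>t y. blinfun_scaleR_left (f t y)"])
    show "((\<lambda>t. oint c (b t') (f t)) has_derivative (*) (oint c (b t') (f' t'))) (at t')" for t'
      using 1[of "b t'" t'] by (simp add: has_field_derivative_def)
    show "((\<lambda>y. oint c y (f s)) has_derivative blinfun_apply (blinfun_scaleR_left (f s y))) (at y)"
      for s y
    proof -
      have "blinfun_apply (blinfun_scaleR_left (f s y)) = (*) (f s y)"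
        by (rule ext) simp
      then show ?thesis
        using oint_deriv[OF fc, where a = c and x = y] by (simp add: has_field_derivative_def)
    qed
    have "continuous_on UNIV (\<lambda>(t, y). blinfun_scaleR_left (f t y) :: real \<Rightarrow>\<^sub>L real)"
      using f unfolding split_beta by (intro continuous_intros)
    then show "continuous (at (t, b t) within UNIV \<times> UNIV)
        (\<lambda>(t, y). blinfun_scaleR_left (f t y) :: real \<Rightarrow>\<^sub>L real)"
      by (simp add: continuous_on_eq_continuous_at)
  qed auto
  have 3: "((\<lambda>t. (t, b t)) has_derivative (\<lambda>s. (s, b' * s))) (at t)"
    using has_derivative_Pair[OF has_derivative_ident b[unfolded has_field_derivative_def]] .
  show ?thesis
    unfolding has_field_derivative_def
    using 2 by (intro has_derivative_eq_rhs[OF has_derivative_compose[OF 3,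
      of "\<lambda>(t, y). oint c y (f t)", unfolded split_conv]]) (auto simp: algebra_simps)
qed

lemma oint_leibniz:
  assumes f: "continuous_on UNIV (\<lambda>(t, x). f t x)"
    and f': "continuous_on UNIV (\<lambda>(t, x). f' t x)"
    and deriv: "\<And>t x. ((\<lambda>t. f t x) has_real_derivative f' t x) (at t)"
    and a: "(a has_real_derivative a') (at t)"
    and b: "(b has_real_derivative b') (at t)"
  shows "((\<lambda>t. oint (a t) (b t) (f t)) has_real_derivative
    oint (a t) (b t) (f' t) + b' * f t (b t) - a' * f t (a t)) (at t)"
proof -
  have fc: "continuous_on UNIV (f t)" "continuous_on UNIV (f' t)" for t
    by (intro continuous_on_comp2[OF f] continuous_on_comp2[OF f'] continuous_intros)+
  show ?thesis
    unfolding oint_split[OF fc(1), where c = 0 and a = "a _"] oint_split[OF fc(2), where c = 0 and a = "a _"]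
    by (rule DERIV_cong[OF DERIV_diff[OF oint_leibniz_upper[OF f f' deriv b]
      oint_leibniz_upper[OF f f' deriv a]]]) simp
qed

text \<open>
  The time derivative of an integral over a fixed interval, for an integrand that is differentiable
  only along the lines \<open>x - \<sigma> t = const\<close>: in the coordinates moving with speed \<open>\<sigma>\<close> the endpoints
  move instead, which produces the flux terms.
\<close>

lemma oint_transport:
  assumes f: "continuous_on UNIV (\<lambda>(t, x). f t x)"
    and g: "continuous_on UNIV (\<lambda>(t, x). g t x)"
    and deriv: "\<And>t x. ((\<lambda>t. f t (x + \<sigma> * t)) has_real_derivative g t (x + \<sigma> * t)) (at t)"
  shows "((\<lambda>t. oint a b (f t)) has_real_derivative
    oint a b (g t) - \<sigma> * (f t b - f t a)) (at t)"
proof -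
  have c: "continuous_on UNIV (\<lambda>(t, x). f t (x + \<sigma> * t))"
    "continuous_on UNIV (\<lambda>(t, x). g t (x + \<sigma> * t))"
    unfolding split_beta
    by (intro continuous_on_comp2[OF f] continuous_on_comp2[OF g] continuous_intros)+
  have "((\<lambda>t. oint (a - \<sigma> * t) (b - \<sigma> * t) (\<lambda>x. f t (x + \<sigma> * t))) has_real_derivative
      oint (a - \<sigma> * t) (b - \<sigma> * t) (\<lambda>x. g t (x + \<sigma> * t)) + (- \<sigma>) * f t (b - \<sigma> * t + \<sigma> * t)
        - (- \<sigma>) * f t (a - \<sigma> * t + \<sigma> * t)) (at t)"
    by (rule oint_leibniz[OF c deriv]) (auto intro!: derivative_eq_intros)
  then show ?thesis
    by (simp add: oint_shift algebra_simps)
qed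

section \<open>The linear wave equation with compactly supported forcing\<close>

lemma oint_deriv_limits:
  assumes f: "continuous_on UNIV f"
    and "(a has_real_derivative a') (at t)" "(b has_real_derivative b') (at t)"
  shows "((\<lambda>t. oint (a t) (b t) f) has_real_derivative b' * f (b t) - a' * f (a t)) (at t)"
proof -
  have "((\<lambda>t. oint 0 (b t) f - oint 0 (a t) f) has_real_derivative f (b t) * b' - f (a t) * a') (at t)"
    by (intro DERIV_diff DERIV_chain2[OF oint_deriv[OF f]] assms)
  then show ?thesis
    by (simp add: oint_split[OF f, where c = 0 and a = "a _"] mult.commute)
qed

text \<open>
  A continuous forcing supported in \<open>|y| \<le> 1\<close>. The constant \<open>c\<close> is the linear
  wave at late times.
\<close>

locale forced_wave =
  fixes F :: "real \<Rightarrow> real \<Rightarrow> real" and c :: real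
  assumes cont_F: "continuous_on UNIV (\<lambda>(s, y). F s y)"
    and F_outside: "1 \<le> \<bar>y\<bar> \<Longrightarrow> F s y = 0"
begin

text \<open>
  The functions \<open>p\<close> and \<open>q\<close> play the role of \<open>v\<^sub>t + v\<^sub>x\<close> and \<open>v\<^sub>t - v\<^sub>x\<close>. They are
  defined by integrating the forcing along characteristics, for all real times.
\<close>

definition p :: "real \<Rightarrow> real \<Rightarrow> real" where
  "p t x = - oint 0 t (\<lambda>s. F s (x + t - s))"

definition q :: "real \<Rightarrow> real \<Rightarrow> real" where
  "q t x = - oint 0 t (\<lambda>s. F s (x - t + s))"

text \<open>
  The solution of the wave equation with forcing \<open>F\<close> that equals \<open>c\<close> at time \<open>0\<close>
  and is at rest there.
\<close>

definition v :: "real \<Rightarrow> real \<Rightarrow> real" where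
  "v t x = c - oint 0 t (\<lambda>s. oint (x - (t - s)) (x + (t - s)) (F s)) / 2"

lemma cont_F1: "continuous_on A (F s)"
  by (intro continuous_on_comp2[OF cont_F] continuous_intros)

lemma cont_p: "continuous_on UNIV (\<lambda>(t, x). p t x)"
  unfolding p_def split_beta
  by (intro continuous_intros continuous_on_oint)
    (unfold split_beta, intro continuous_on_comp2[OF cont_F] continuous_intros)

lemma cont_q: "continuous_on UNIV (\<lambda>(t, x). q t x)"
  unfolding q_def split_beta
  by (intro continuous_intros continuous_on_oint)
    (unfold split_beta, intro continuous_on_comp2[OF cont_F] continuous_intros)

lemma cont_v: "continuous_on UNIV (\<lambda>(t, x). v t x)"
  unfolding v_def split_beta
  by (intro continuous_intros continuous_on_oint) (unfold split_beta,
    intro continuous_intros continuous_on_oint, unfold split_beta,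
    intro continuous_on_comp2[OF cont_F] continuous_intros, simp)

lemma cont_pqv [continuous_intros]:
  assumes "continuous_on A h" "continuous_on A k"
  shows "continuous_on A (\<lambda>z. p (h z) (k z))" "continuous_on A (\<lambda>z. q (h z) (k z))"
    "continuous_on A (\<lambda>z. v (h z) (k z))" "continuous_on A (\<lambda>z. F (h z) (k z))"
  by (intro continuous_on_comp2[OF cont_p] continuous_on_comp2[OF cont_q]
    continuous_on_comp2[OF cont_v] continuous_on_comp2[OF cont_F] assms)+

lemma deriv_p_left: "((\<lambda>t. p t (x + (- 1) * t)) has_real_derivative - F t (x + (- 1) * t)) (at t)"
proof -
  have "((\<lambda>t. - oint 0 t (\<lambda>s. F s (x - s))) has_real_derivative - F t (x - t)) (at t)"
    by (intro DERIV_minus oint_deriv continuous_intros)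
  then show ?thesis
    by (simp add: p_def)
qed

lemma deriv_q_right: "((\<lambda>t. q t (x + 1 * t)) has_real_derivative - F t (x + 1 * t)) (at t)"
proof -
  have "((\<lambda>t. - oint 0 t (\<lambda>s. F s (x + s))) has_real_derivative - F t (x + t)) (at t)"
    by (intro DERIV_minus oint_deriv continuous_intros)
  then show ?thesis
    by (simp add: q_def)
qed

text \<open>
  The derivative in the direction of speed \<open>\<sigma>\<close>. The values \<open>\<sigma> = 1\<close>, \<open>-1\<close> and \<open>0\<close> give the two
  characteristic derivatives \<open>p\<close> and \<open>q\<close> and the time derivative.
\<close>

lemma deriv_v_direction:
  "((\<lambda>t. v t (x + \<sigma> * t)) has_real_derivative
    ((1 + \<sigma>) * p t (x + \<sigma> * t) + (1 - \<sigma>) * q t (x + \<sigma> * t)) / 2) (at t)"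
proof -
  let ?l = "\<lambda>t s. x + \<sigma> * t - (t - s)" and ?u = "\<lambda>t s. x + \<sigma> * t + (t - s)"
  have "((\<lambda>t. oint 0 t (\<lambda>s. oint (?l t s) (?u t s) (F s))) has_real_derivative
      oint 0 t (\<lambda>s. (\<sigma> + 1) * F s (?u t s) - (\<sigma> - 1) * F s (?l t s))
      + 1 * oint (?l t t) (?u t t) (F t)) (at t)"
  proof (rule oint_leibniz_upper)
    show "continuous_on UNIV (\<lambda>(t, s). oint (?l t s) (?u t s) (F s))"
      unfolding split_beta
      by (intro continuous_on_oint continuous_intros) (unfold split_beta, intro continuous_intros)
    show "continuous_on UNIV (\<lambda>(t, s). (\<sigma> + 1) * F s (?u t s) - (\<sigma> - 1) * F s (?l t s))"
      unfolding split_beta by (intro continuous_intros)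
    show "((\<lambda>t. oint (?l t s) (?u t s) (F s)) has_real_derivative
        (\<sigma> + 1) * F s (?u t s) - (\<sigma> - 1) * F s (?l t s)) (at t)" for t s
      by (rule oint_deriv_limits[OF cont_F1]) (auto intro!: derivative_eq_intros)
  qed auto
  then have D: "((\<lambda>t. c - oint 0 t (\<lambda>s. oint (?l t s) (?u t s) (F s)) / 2) has_real_derivative
      0 - (oint 0 t (\<lambda>s. (\<sigma> + 1) * F s (?u t s) - (\<sigma> - 1) * F s (?l t s))
      + 1 * oint (?l t t) (?u t t) (F t)) / 2) (at t)"
    by (intro DERIV_diff DERIV_const DERIV_cdivide)
  have eq: "oint 0 t (\<lambda>s. (\<sigma> + 1) * F s (?u t s) - (\<sigma> - 1) * F s (?l t s))
      = (\<sigma> + 1) * oint 0 t (\<lambda>s. F s (?u t s)) - (\<sigma> - 1) * oint 0 t (\<lambda>s. F s (?l t s))"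
    by (subst oint_diff) (intro continuous_intros | simp add: oint_cmult)+
  with D show ?thesis
    unfolding v_def p_def q_def by (elim DERIV_cong) (unfold eq, simp add: field_simps)
qed

lemma deriv_v_space: "(v t has_real_derivative (p t x - q t x) / 2) (at x)"
proof -
  let ?l = "\<lambda>x s. x - (t - s)" and ?u = "\<lambda>x s. x + (t - s)"
  have "((\<lambda>x. oint 0 t (\<lambda>s. oint (?l x s) (?u x s) (F s))) has_real_derivative
      oint 0 t (\<lambda>s. 1 * F s (?u x s) - 1 * F s (?l x s))
      + 0 * oint (?l x t) (?u x t) (F t)) (at x)"
  proof (rule oint_leibniz_upper)
    show "continuous_on UNIV (\<lambda>(x, s). oint (?l x s) (?u x s) (F s))"
      unfolding split_beta
      by (intro continuous_on_oint continuous_intros) (unfold split_beta, intro continuous_intros)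
    show "continuous_on UNIV (\<lambda>(x, s). 1 * F s (?u x s) - 1 * F s (?l x s))"
      unfolding split_beta by (intro continuous_intros)
    show "((\<lambda>x. oint (?l x s) (?u x s) (F s)) has_real_derivative
        1 * F s (?u x s) - 1 * F s (?l x s)) (at x)" for x s
      by (rule oint_deriv_limits[OF cont_F1]) (auto intro!: derivative_eq_intros)
  qed auto
  then have D: "((\<lambda>x. c - oint 0 t (\<lambda>s. oint (?l x s) (?u x s) (F s)) / 2) has_real_derivative
      0 - (oint 0 t (\<lambda>s. 1 * F s (?u x s) - 1 * F s (?l x s))
      + 0 * oint (?l x t) (?u x t) (F t)) / 2) (at x)"
    by (intro DERIV_diff DERIV_const DERIV_cdivide)
  have eq: "oint 0 t (\<lambda>s. 1 * F s (?u x s) - 1 * F s (?l x s))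
      = oint 0 t (\<lambda>s. F s (?u x s)) - oint 0 t (\<lambda>s. F s (?l x s))"
    by (subst oint_diff) (intro continuous_intros | simp)+
  with D show ?thesis
    unfolding v_def[abs_def] p_def q_def by (elim DERIV_cong) (unfold eq, simp add: field_simps)
qed

lemma p_outside: "p t x = 0" if "0 \<le> t" "1 \<le> x"
proof -
  have "oint 0 t (\<lambda>s. F s (x + t - s)) = oint 0 t (\<lambda>s. 0)"
    by (rule oint_cong) (use that in \<open>auto intro!: F_outside\<close>)
  then show ?thesis by (simp add: p_def oint_const)
qed

lemma q_outside: "q t x = 0" if "0 \<le> t" "x \<le> -1"
proof -
  have "oint 0 t (\<lambda>s. F s (x - t + s)) = oint 0 t (\<lambda>s. 0)"
    by (rule oint_cong) (use that in \<open>auto intro!: F_outside\<close>)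
  then show ?thesis by (simp add: q_def oint_const)
qed

text \<open>
  To the right of the support of the forcing \<open>v\<close> is constant along lines of speed \<open>1\<close>,
  because \<open>p\<close> vanishes there.
\<close>

lemma v_outgoing_right: "v t x = v (t - (x - 1)) 1" if "1 \<le> x" "x - 1 \<le> t"
proof -
  let ?f = "\<lambda>r. v r (x - t + 1 * r)"
  have "?f t = ?f (t - (x - 1))" if "1 < x"
  proof (rule DERIV_isconst_end[where f = ?f])
    fix r assume r: "t - (x - 1) < r" "r < t"
    have "p r (x - t + 1 * r) = 0"
      by (rule p_outside) (use r \<open>x - 1 \<le> t\<close> in auto)
    then show "(?f has_real_derivative 0) (at r)"
      using deriv_v_direction[where \<sigma> = 1 and x = "x - t" and t = r] by simp
  qed (use that in \<open>auto intro!: continuous_intros\<close>)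
  then show ?thesis using that by (cases "x = 1") auto
qed

lemma v_outgoing_left: "v t x = v (t - (- x - 1)) (- 1)" if "x \<le> - 1" "- x - 1 \<le> t"
proof -
  let ?f = "\<lambda>r. v r (x + t + (- 1) * r)"
  have "?f t = ?f (t - (- x - 1))" if "x < - 1"
  proof (rule DERIV_isconst_end[where f = ?f])
    fix r assume r: "t - (- x - 1) < r" "r < t"
    have "q r (x + t + (- 1) * r) = 0"
      by (rule q_outside) (use r \<open>- x - 1 \<le> t\<close> in auto)
    then show "(?f has_real_derivative 0) (at r)"
      using deriv_v_direction[where \<sigma> = "- 1" and x = "x + t" and t = r] by simp
  qed (use that in \<open>auto intro!: continuous_intros\<close>)
  then show ?thesis using that by (cases "x = - 1") auto
qed

end

section \<open>Energy and Morawetz identities\<close>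

lemma oint_linear_combination:
  assumes "continuous_on UNIV f1" "continuous_on UNIV f2" "continuous_on UNIV f3"
    "continuous_on UNIV f4" "continuous_on UNIV f5"
  shows "oint a b (\<lambda>x. f1 x + c2 * f2 x + c3 * f3 x + c4 * f4 x + c5 * f5 x)
    = oint a b f1 + c2 * oint a b f2 + c3 * oint a b f3 + c4 * oint a b f4 + c5 * oint a b f5"
  by (simp add: oint_add oint_cmult assms continuous_on_add continuous_on_mult_left)

text \<open>
  The forcing is the defocusing cubic term once \<open>T0\<close> has passed. Before that time it
  is only required to be continuous, so the identities below hold for \<open>t > T0\<close> only.
\<close>

locale defocusing_wave = forced_wave +
  fixes K K' :: "real \<Rightarrow> real" and T0 :: real
  assumes K_deriv: "(K has_real_derivative K' x) (at x)"
    and cont_K': "continuous_on UNIV K'"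
    and K_nonneg: "0 \<le> K x"
    and K_outside: "1 \<le> \<bar>x\<bar> \<Longrightarrow> K x = 0"
    and K_pos: "0 < K 0"
    and K_repulsive: "x * K' x \<le> 0"
    and T0_nonneg: "0 \<le> T0"
    and F_cubic: "T0 < t \<Longrightarrow> \<bar>x\<bar> \<le> 1 \<Longrightarrow> F t x = K x * v t x ^ 3"
begin

abbreviation I :: "(real \<Rightarrow> real) \<Rightarrow> real" where
  "I \<equiv> oint (- 1) 1"

lemma cont_K: "continuous_on UNIV K"
  by (rule DERIV_continuous_on) (rule has_field_derivative_at_within[OF K_deriv])

lemma cont_K_comp [continuous_intros]:
  assumes "continuous_on A h"
  shows "continuous_on A (\<lambda>x. K (h x))" "continuous_on A (\<lambda>x. K' (h x))"
  using continuous_on_compose2[OF cont_K assms] continuous_on_compose2[OF cont_K' assms] by auto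

lemma deriv_weighted_p2:
  assumes "\<And>x. (a has_real_derivative a' x) (at x)"
    and "continuous_on UNIV a" "continuous_on UNIV a'"
  shows "((\<lambda>t. I (\<lambda>x. a x * p t x ^ 2)) has_real_derivative
    I (\<lambda>x. - a' x * p t x ^ 2 - 2 * a x * p t x * F t x) + a 1 * p t 1 ^ 2 - a (- 1) * p t (- 1) ^ 2)
    (at t)"
proof -
  have [continuous_intros]: "continuous_on A (\<lambda>x. a (h x))" "continuous_on A (\<lambda>x. a' (h x))"
    if "continuous_on A h" for A :: "(real \<times> real) set" and h
    using continuous_on_compose2[OF assms(2) that] continuous_on_compose2[OF assms(3) that] by auto
  have "((\<lambda>t. I (\<lambda>x. a x * p t x ^ 2)) has_real_derivative
    I (\<lambda>x. - a' x * p t x ^ 2 - 2 * a x * p t x * F t x)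
      - (- 1) * (a 1 * p t 1 ^ 2 - a (- 1) * p t (- 1) ^ 2)) (at t)"
  proof (rule oint_transport)
    show "((\<lambda>t. a (x + - 1 * t) * (p t (x + - 1 * t))\<^sup>2) has_real_derivative
        - a' (x + - 1 * t) * (p t (x + - 1 * t))\<^sup>2
        - 2 * a (x + - 1 * t) * p t (x + - 1 * t) * F t (x + - 1 * t)) (at t)" for t x
      by (rule derivative_eq_intros DERIV_chain2[OF assms(1)] deriv_p_left refl)+ (simp add: algebra_simps)
  qed (unfold split_beta, (intro continuous_intros)+)
  then show ?thesis by (simp add: algebra_simps)
qed

lemma deriv_weighted_q2:
  assumes "\<And>x. (a has_real_derivative a' x) (at x)"
    and "continuous_on UNIV a" "continuous_on UNIV a'"
  shows "((\<lambda>t. I (\<lambda>x. a x * q t x ^ 2)) has_real_derivative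
    I (\<lambda>x. a' x * q t x ^ 2 - 2 * a x * q t x * F t x) - (a 1 * q t 1 ^ 2 - a (- 1) * q t (- 1) ^ 2))
    (at t)"
proof -
  have [continuous_intros]: "continuous_on A (\<lambda>x. a (h x))" "continuous_on A (\<lambda>x. a' (h x))"
    if "continuous_on A h" for A :: "(real \<times> real) set" and h
    using continuous_on_compose2[OF assms(2) that] continuous_on_compose2[OF assms(3) that] by auto
  have "((\<lambda>t. I (\<lambda>x. a x * q t x ^ 2)) has_real_derivative
    I (\<lambda>x. a' x * q t x ^ 2 - 2 * a x * q t x * F t x)
      - 1 * (a 1 * q t 1 ^ 2 - a (- 1) * q t (- 1) ^ 2)) (at t)"
  proof (rule oint_transport)
    show "((\<lambda>t. a (x + 1 * t) * (q t (x + 1 * t))\<^sup>2) has_real_derivative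
        a' (x + 1 * t) * (q t (x + 1 * t))\<^sup>2
        - 2 * a (x + 1 * t) * q t (x + 1 * t) * F t (x + 1 * t)) (at t)" for t x
      by (rule derivative_eq_intros DERIV_chain2[OF assms(1)] deriv_q_right refl)+ (simp add: algebra_simps)
  qed (unfold split_beta, (intro continuous_intros)+)
  then show ?thesis by simp
qed

lemma deriv_v_left: "((\<lambda>t. v t (x + (- 1) * t)) has_real_derivative q t (x + (- 1) * t)) (at t)"
  using deriv_v_direction[of x "- 1" t] by simp

lemma deriv_v_right: "((\<lambda>t. v t (x + 1 * t)) has_real_derivative p t (x + 1 * t)) (at t)"
  using deriv_v_direction[of x 1 t] by simp

text \<open>
  Differentiating the potential energy in the two characteristic directions gives two formulas
  for the same derivative. Their average has no \<open>b'\<close>, and their difference amounts to integrating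
  the term with \<open>v\<^sup>3 v\<^sub>x\<close> by parts.
\<close>

lemma deriv_weighted_v4:
  assumes b: "\<And>x. (b has_real_derivative b' x) (at x)"
    and "continuous_on UNIV b" "continuous_on UNIV b'" and b0: "b 1 = 0" "b (- 1) = 0"
  shows "((\<lambda>t. I (\<lambda>x. b x * v t x ^ 4)) has_real_derivative
      I (\<lambda>x. - b' x * v t x ^ 4 + 4 * b x * v t x ^ 3 * q t x)) (at t)" (is ?left)
    and "((\<lambda>t. I (\<lambda>x. b x * v t x ^ 4)) has_real_derivative
      I (\<lambda>x. b' x * v t x ^ 4 + 4 * b x * v t x ^ 3 * p t x)) (at t)" (is ?right)
proof -
  have [continuous_intros]: "continuous_on A (\<lambda>x. b (h x))" "continuous_on A (\<lambda>x. b' (h x))"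
    if "continuous_on A h" for A :: "(real \<times> real) set" and h
    using continuous_on_compose2[OF assms(2) that] continuous_on_compose2[OF assms(3) that] by auto
  have "((\<lambda>t. I (\<lambda>x. b x * v t x ^ 4)) has_real_derivative
      I (\<lambda>x. - b' x * v t x ^ 4 + 4 * b x * v t x ^ 3 * q t x)
      - (- 1) * (b 1 * v t 1 ^ 4 - b (- 1) * v t (- 1) ^ 4)) (at t)"
  proof (rule oint_transport)
    show "((\<lambda>t. b (x + - 1 * t) * v t (x + - 1 * t) ^ 4) has_real_derivative
        - b' (x + - 1 * t) * v t (x + - 1 * t) ^ 4
        + 4 * b (x + - 1 * t) * v t (x + - 1 * t) ^ 3 * q t (x + - 1 * t)) (at t)" for t x
      by (rule derivative_eq_intros DERIV_chain2[OF b] deriv_v_left refl)+ (simp add: algebra_simps)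
  qed (unfold split_beta, (intro continuous_intros)+)
  then show ?left using b0 by simp
  have "((\<lambda>t. I (\<lambda>x. b x * v t x ^ 4)) has_real_derivative
      I (\<lambda>x. b' x * v t x ^ 4 + 4 * b x * v t x ^ 3 * p t x)
      - 1 * (b 1 * v t 1 ^ 4 - b (- 1) * v t (- 1) ^ 4)) (at t)"
  proof (rule oint_transport)
    show "((\<lambda>t. b (x + 1 * t) * v t (x + 1 * t) ^ 4) has_real_derivative
        b' (x + 1 * t) * v t (x + 1 * t) ^ 4
        + 4 * b (x + 1 * t) * v t (x + 1 * t) ^ 3 * p t (x + 1 * t)) (at t)" for t x
      by (rule derivative_eq_intros DERIV_chain2[OF b] deriv_v_right refl)+ (simp add: algebra_simps)
  qed (unfold split_beta, (intro continuous_intros)+)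
  then show ?right using b0 by simp
qed

lemma deriv_vp:
  "((\<lambda>t. I (\<lambda>x. v t x * p t x)) has_real_derivative
    I (\<lambda>x. p t x * q t x - v t x * F t x) + (v t 1 * p t 1 - v t (- 1) * p t (- 1))) (at t)"
proof -
  have "((\<lambda>t. I (\<lambda>x. v t x * p t x)) has_real_derivative
      I (\<lambda>x. p t x * q t x - v t x * F t x) - (- 1) * (v t 1 * p t 1 - v t (- 1) * p t (- 1))) (at t)"
  proof (rule oint_transport)
    show "((\<lambda>t. v t (x + - 1 * t) * p t (x + - 1 * t)) has_real_derivative
        p t (x + - 1 * t) * q t (x + - 1 * t) - v t (x + - 1 * t) * F t (x + - 1 * t)) (at t)" for t x
      by (rule derivative_eq_intros deriv_v_left deriv_p_left refl)+ (simp add: algebra_simps)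
  qed (unfold split_beta, (intro continuous_intros)+)
  then show ?thesis by (simp add: algebra_simps)
qed

lemma deriv_vq:
  "((\<lambda>t. I (\<lambda>x. v t x * q t x)) has_real_derivative
    I (\<lambda>x. p t x * q t x - v t x * F t x) - (v t 1 * q t 1 - v t (- 1) * q t (- 1))) (at t)"
proof -
  have "((\<lambda>t. I (\<lambda>x. v t x * q t x)) has_real_derivative
      I (\<lambda>x. p t x * q t x - v t x * F t x) - 1 * (v t 1 * q t 1 - v t (- 1) * q t (- 1))) (at t)"
  proof (rule oint_transport)
    show "((\<lambda>t. v t (x + 1 * t) * q t (x + 1 * t)) has_real_derivative
        p t (x + 1 * t) * q t (x + 1 * t) - v t (x + 1 * t) * F t (x + 1 * t)) (at t)" for t x
      by (rule derivative_eq_intros deriv_v_right deriv_q_right refl)+ (simp add: algebra_simps)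
  qed (unfold split_beta, (intro continuous_intros)+)
  then show ?thesis by simp
qed

lemma deriv_v_time: "((\<lambda>t. v t x) has_real_derivative (p t x + q t x) / 2) (at t)"
  using deriv_v_direction[of x 0 t] by simp

text \<open>
  Four times the energy in \<open>[-1, 1]\<close>, because
  \<open>p\<^sup>2 + q\<^sup>2 = 2 (v\<^sub>t\<^sup>2 + v\<^sub>x\<^sup>2)\<close>.
\<close>

definition energy :: "real \<Rightarrow> real" where
  "energy t = I (\<lambda>x. p t x ^ 2) + I (\<lambda>x. q t x ^ 2) + I (\<lambda>x. K x * v t x ^ 4)"

lemma energy_terms_nonneg:
  "0 \<le> I (\<lambda>x. p t x ^ 2)" "0 \<le> I (\<lambda>x. q t x ^ 2)" "0 \<le> I (\<lambda>x. K x * v t x ^ 4)"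
  by (auto intro!: oint_nonneg continuous_intros mult_nonneg_nonneg K_nonneg)

lemma deriv_energy:
  assumes t: "T0 < t"
  shows "(energy has_real_derivative - (p t (- 1) ^ 2 + q t 1 ^ 2)) (at t)"
proof -
  have t0: "0 \<le> t" using t T0_nonneg by simp
  have P: "((\<lambda>t. I (\<lambda>x. 1 * p t x ^ 2)) has_real_derivative
      I (\<lambda>x. - 0 * p t x ^ 2 - 2 * 1 * p t x * F t x) + 1 * p t 1 ^ 2 - 1 * p t (- 1) ^ 2) (at t)"
    by (rule deriv_weighted_p2) (auto intro!: continuous_intros)
  have Q: "((\<lambda>t. I (\<lambda>x. 1 * q t x ^ 2)) has_real_derivative
      I (\<lambda>x. 0 * q t x ^ 2 - 2 * 1 * q t x * F t x) - (1 * q t 1 ^ 2 - 1 * q t (- 1) ^ 2)) (at t)"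
    by (rule deriv_weighted_q2) (auto intro!: continuous_intros)
  let ?A = "\<lambda>x. - 0 * p t x ^ 2 - 2 * 1 * p t x * F t x"
  let ?B = "\<lambda>x. 0 * q t x ^ 2 - 2 * 1 * q t x * F t x"
  let ?C = "\<lambda>x. - K' x * v t x ^ 4 + 4 * K x * v t x ^ 3 * q t x"
  let ?D = "\<lambda>x. K' x * v t x ^ 4 + 4 * K x * v t x ^ 3 * p t x"
  note V = deriv_weighted_v4[OF K_deriv cont_K cont_K' K_outside K_outside, simplified, of t]
  have E: "(energy has_real_derivative I ?A + 1 * p t 1 ^ 2 - 1 * p t (- 1) ^ 2
      + (I ?B - (1 * q t 1 ^ 2 - 1 * q t (- 1) ^ 2)) + I ?D) (at t)"
    using DERIV_add[OF DERIV_add[OF P Q] V(2)] by (simp add: energy_def[abs_def])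
  have "I ?C = I ?D"
    using DERIV_unique[OF V] by simp
  then have "I ?A + I ?B + I ?D = I ?A + 1 * I ?B + 1/2 * I ?C + 1/2 * I ?D + 0 * I ?D"
    by simp
  also have "\<dots> = I (\<lambda>x. ?A x + 1 * ?B x + 1/2 * ?C x + 1/2 * ?D x + 0 * ?D x)"
    by (rule oint_linear_combination[symmetric]; intro continuous_intros)
  also have "\<dots> = I (\<lambda>x. 0)"
    by (rule oint_cong) (use t in \<open>auto simp: F_cubic algebra_simps\<close>)
  finally have "I ?A + I ?B + I ?D = 0" by (simp add: oint_const)
  moreover have "p t 1 = 0" "q t (- 1) = 0"
    using t0 by (auto intro: p_outside q_outside)
  ultimately show ?thesis
    using E by (elim DERIV_cong) simp
qed

text \<open>
  The Morawetz functional for the multiplier \<open>x v\<^sub>x + 3/8 v\<close>, up to a factor \<open>4\<close>,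
  since \<open>p\<^sup>2 - q\<^sup>2 = 4 v\<^sub>t v\<^sub>x\<close> and \<open>p + q = 2 v\<^sub>t\<close>. The boundary
  terms of \<open>\<integral> v (p + q)\<close> are exact derivatives, because \<open>v\<^sub>t\<close> is \<open>q / 2\<close> at
  \<open>1\<close> and \<open>p / 2\<close> at \<open>-1\<close>; the last summand cancels them.
\<close>

definition morawetz :: "real \<Rightarrow> real" where
  "morawetz t = I (\<lambda>x. x * p t x ^ 2) - I (\<lambda>x. x * q t x ^ 2)
    + 3 / 4 * (I (\<lambda>x. v t x * p t x) + I (\<lambda>x. v t x * q t x))
    + 3 / 4 * (v t 1 ^ 2 + v t (- 1) ^ 2)"

lemma deriv_morawetz:
  assumes t: "T0 < t"
  obtains D where "((\<lambda>t. morawetz t + energy t) has_real_derivative D) (at t)" "D \<le> - energy t / 4"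
proof -
  have t0: "0 \<le> t" using t T0_nonneg by simp
  have bd: "p t 1 = 0" "q t (- 1) = 0"
    using t0 by (auto intro: p_outside q_outside)
  let ?A = "\<lambda>x. - 1 * p t x ^ 2 - 2 * x * p t x * F t x"
  let ?B = "\<lambda>x. 1 * q t x ^ 2 - 2 * x * q t x * F t x"
  let ?L = "\<lambda>x. p t x * q t x - v t x * F t x"
  have P: "((\<lambda>t. I (\<lambda>x. x * p t x ^ 2)) has_real_derivative
      I ?A + 1 * p t 1 ^ 2 - (- 1) * p t (- 1) ^ 2) (at t)"
    by (rule deriv_weighted_p2) (auto intro!: continuous_intros)
  have Q: "((\<lambda>t. I (\<lambda>x. x * q t x ^ 2)) has_real_derivative
      I ?B - (1 * q t 1 ^ 2 - (- 1) * q t (- 1) ^ 2)) (at t)"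
    by (rule deriv_weighted_q2) (auto intro!: continuous_intros)
  have S: "((\<lambda>t. v t 1 ^ 2 + v t (- 1) ^ 2) has_real_derivative
      v t 1 * q t 1 + v t (- 1) * p t (- 1)) (at t)"
    by (rule derivative_eq_intros deriv_v_time refl)+ (simp add: bd)
  define D where "D = I ?A + 1 * p t 1 ^ 2 - (- 1) * p t (- 1) ^ 2
      - (I ?B - (1 * q t 1 ^ 2 - (- 1) * q t (- 1) ^ 2))
      + 3 / 4 * (I ?L + (v t 1 * p t 1 - v t (- 1) * p t (- 1))
        + (I ?L - (v t 1 * q t 1 - v t (- 1) * q t (- 1))))
      + 3 / 4 * (v t 1 * q t 1 + v t (- 1) * p t (- 1)) + - (p t (- 1) ^ 2 + q t 1 ^ 2)"
  have deriv: "((\<lambda>t. morawetz t + energy t) has_real_derivative D) (at t)"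
    unfolding morawetz_def D_def
    by (intro DERIV_add DERIV_diff DERIV_cmult P Q S deriv_vp deriv_vq deriv_energy[OF t])
  let ?b = "\<lambda>x. x * K x" and ?b' = "\<lambda>x. K x + x * K' x"
  let ?U = "\<lambda>x. - ?b' x * v t x ^ 4 + 4 * ?b x * v t x ^ 3 * q t x"
  let ?W = "\<lambda>x. ?b' x * v t x ^ 4 + 4 * ?b x * v t x ^ 3 * p t x"
  have b: "(?b has_real_derivative ?b' x) (at x)" for x
    by (rule derivative_eq_intros K_deriv refl)+ simp
  \<comment> \<open>The two formulas for the derivative of the potential energy with weight \<open>x K\<close> agree.\<close>
  have UW: "I ?U = I ?W"
    by (rule DERIV_unique[OF deriv_weighted_v4[where b = ?b and b' = ?b']])
      (use b K_outside in \<open>auto intro!: continuous_intros\<close>)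
  have "D = I ?A + (- 1) * I ?B + 3 / 2 * I ?L + 1 / 2 * I ?W + (- 1 / 2) * I ?U"
    unfolding D_def UW by (simp add: bd algebra_simps)
  also have "\<dots> = I (\<lambda>x. ?A x + (- 1) * ?B x + 3 / 2 * ?L x + 1 / 2 * ?W x + (- 1 / 2) * ?U x)"
    by (rule oint_linear_combination[symmetric]; intro continuous_intros)
  also have "\<dots> \<le> I (\<lambda>x. (- 1 / 4) * (p t x ^ 2 + q t x ^ 2 + K x * v t x ^ 4))"
  proof (rule oint_mono)
    fix x :: real assume "x \<in> {- 1..1}"
    then have F: "F t x = K x * v t x ^ 3" using t by (auto simp: F_cubic)
    have "?A x + (- 1) * ?B x + 3 / 2 * ?L x + 1 / 2 * ?W x + (- 1 / 2) * ?U x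
        = - (p t x ^ 2) - q t x ^ 2 + 3 / 2 * p t x * q t x - 1 / 2 * (K x * v t x ^ 4)
          + (x * K' x) * v t x ^ 4"
      unfolding F by (simp add: algebra_simps power_numeral_reduce)
    also have "\<dots> \<le> - (p t x ^ 2) - q t x ^ 2 + 3 / 2 * p t x * q t x - 1 / 2 * (K x * v t x ^ 4) + 0"
      by (intro add_left_mono mult_nonpos_nonneg K_repulsive) auto
    also have "\<dots> \<le> (- 1 / 4) * (p t x ^ 2 + q t x ^ 2 + K x * v t x ^ 4)"
    proof -
      have "0 \<le> K x * v t x ^ 4" using K_nonneg by simp
      moreover have "0 \<le> (p t x - q t x)\<^sup>2" by simp
      ultimately show ?thesis by (simp add: power2_diff algebra_simps)
    qed
    finally show "?A x + (- 1) * ?B x + 3 / 2 * ?L x + 1 / 2 * ?W x + (- 1 / 2) * ?U x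
      \<le> (- 1 / 4) * (p t x ^ 2 + q t x ^ 2 + K x * v t x ^ 4)" .
  qed (intro continuous_intros | simp)+
  also have "\<dots> = - energy t / 4"
  proof -
    have "continuous_on UNIV (\<lambda>x. p t x ^ 2)" "continuous_on UNIV (\<lambda>x. q t x ^ 2)"
      "continuous_on UNIV (\<lambda>x. K x * v t x ^ 4)"
      by (intro continuous_intros)+
    then have "I (\<lambda>x. p t x ^ 2 + q t x ^ 2 + K x * v t x ^ 4) = energy t"
      unfolding energy_def by (simp add: oint_add continuous_on_add)
    then show ?thesis
      unfolding oint_cmult by simp
  qed
  finally show ?thesis using deriv that by blast
qed

end

section \<open>Local decay\<close>

context defocusing_wave
begin

lemma energy_nonneg: "0 \<le> energy t"
  using energy_terms_nonneg[of t] by (simp add: energy_def)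

lemma energy_antimono:
  assumes "T0 < s" "s \<le> t"
  shows "energy t \<le> energy s"
proof (rule DERIV_nonpos_imp_nonincreasing[OF assms(2)])
  fix r assume "s \<le> r" "r \<le> t"
  then show "\<exists>y. (energy has_real_derivative y) (at r) \<and> y \<le> 0"
    using deriv_energy[of r] assms by (intro exI[of _ "- (p r (- 1) ^ 2 + q r 1 ^ 2)"]) auto
qed

text \<open>
  The Cauchy--Schwarz inequality in its additive form: the parameter \<open>\<epsilon>\<close> replaces a square root.
\<close>

lemma v_oscillation_le:
  assumes "0 < \<epsilon>" "-1 \<le> y" "y \<le> x" "x \<le> 1"
  shows "\<bar>v t x - v t y\<bar> \<le> \<epsilon> + energy t / \<epsilon>"
proof -
  let ?g = "\<lambda>x. (p t x - q t x) / 2"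
  let ?G = "\<lambda>x. \<epsilon> / 2 + 1 / (4 * \<epsilon>) * (p t x ^ 2 + q t x ^ 2)"
  have cG: "continuous_on UNIV ?G" and cg: "continuous_on UNIV ?g"
    by (intro continuous_intros | simp)+
  have le: "\<bar>?g z\<bar> \<le> ?G z" for z
  proof -
    have "0 \<le> (2 * \<epsilon> - \<bar>p t z - q t z\<bar>)\<^sup>2" "0 \<le> (p t z + q t z)\<^sup>2" by simp_all
    then have "4 * \<epsilon> * \<bar>p t z - q t z\<bar> \<le> 4 * \<epsilon>\<^sup>2 + 2 * (p t z ^ 2 + q t z ^ 2)"
      by (simp add: power2_eq_square algebra_simps)
    then have "\<bar>p t z - q t z\<bar> \<le> (4 * \<epsilon>\<^sup>2 + 2 * (p t z ^ 2 + q t z ^ 2)) / (4 * \<epsilon>)"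
      using assms(1) by (simp add: field_simps)
    also have "\<dots> = 2 * ?G z"
      using assms(1) by (simp add: field_simps power2_eq_square)
    finally show ?thesis
      unfolding abs_divide abs_numeral by (simp only: pos_divide_le_eq mult.commute zero_less_numeral)
  qed
  have G0: "0 \<le> ?G z" for z using le[of z] by linarith
  have "v t x - v t y = oint y x ?g"
    by (rule oint_FTC[symmetric]) (rule deriv_v_space)
  moreover have "oint y x ?g \<le> oint y x ?G"
    by (rule oint_mono[OF cg cG assms(3)]) (use le abs_le_D1 in blast)
  moreover have "oint y x (\<lambda>z. - ?G z) \<le> oint y x ?g"
    by (rule oint_mono[OF continuous_on_minus[OF cG] cg assms(3)]) (use le in \<open>smt (verit)\<close>)
  moreover have "oint y x ?G \<le> I ?G"
  proof -
    have "0 \<le> oint (- 1) y ?G" "0 \<le> oint x 1 ?G"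
      by (rule oint_nonneg[OF cG _ G0], use assms in simp)+
    then show ?thesis
      using oint_split[OF cG, of y x "- 1"] oint_split[OF cG, of x 1 "- 1"] by linarith
  qed
  moreover have "I ?G \<le> \<epsilon> + energy t / \<epsilon>"
  proof -
    have "I ?G = \<epsilon> + 1 / (4 * \<epsilon>) * (I (\<lambda>x. p t x ^ 2) + I (\<lambda>x. q t x ^ 2))"
      by (subst oint_add, (intro continuous_intros)[1], (intro continuous_intros)[1])
        (simp only: oint_cmult oint_const, subst oint_add,
         (intro continuous_intros)[1], (intro continuous_intros)[1], simp)
    also have "\<dots> \<le> \<epsilon> + 1 / \<epsilon> * energy t"
    proof (intro add_left_mono mult_mono)
      show "I (\<lambda>x. p t x ^ 2) + I (\<lambda>x. q t x ^ 2) \<le> energy t"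
        using energy_terms_nonneg[of t] by (simp add: energy_def)
      show "0 \<le> I (\<lambda>x. p t x ^ 2) + I (\<lambda>x. q t x ^ 2)"
        using energy_terms_nonneg[of t] by simp
    qed (use assms(1) in \<open>auto simp: field_simps\<close>)
    finally show ?thesis by simp
  qed
  ultimately show ?thesis
    unfolding oint_uminus by linarith
qed

text \<open>
  Near \<open>0\<close> the coefficient \<open>K\<close> is bounded below, so the potential energy bounds the minimum of
  \<open>v\<^sup>4\<close> there.
\<close>

lemma v_small_somewhere:
  obtains C where "0 < C" "\<And>t. \<exists>y\<in>{-1..1}. v t y ^ 4 \<le> C * energy t"
proof -
  have "isCont K 0" using K_deriv DERIV_isCont by blast
  then have "\<forall>\<^sub>F x in at 0. K 0 / 2 < K x"
    using K_pos order_tendstoD(1)[of K "K 0" "at 0" "K 0 / 2"] by (simp add: isCont_def)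
  then obtain d where d: "0 < d" "\<And>x. x \<noteq> 0 \<Longrightarrow> \<bar>x\<bar> < d \<Longrightarrow> K 0 / 2 < K x"
    unfolding eventually_at by (auto simp: dist_real_def)
  define \<delta> where "\<delta> = min (d / 2) 1"
  have \<delta>: "0 < \<delta>" "\<delta> \<le> 1" "\<delta> < d" using d by (auto simp: \<delta>_def)
  have K_low: "K 0 / 2 \<le> K x" if "\<bar>x\<bar> \<le> \<delta>" for x
    using d(2)[of x] that \<delta> K_pos by (cases "x = 0") auto
  show ?thesis
  proof
    show C: "0 < 1 / (K 0 * \<delta>)" using K_pos \<delta> by simp
    fix t
    have "\<exists>y\<in>{-\<delta>..\<delta>}. \<forall>x\<in>{-\<delta>..\<delta>}. v t y ^ 4 \<le> v t x ^ 4"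
      by (rule continuous_attains_inf) (use \<delta> in \<open>auto intro!: continuous_intros\<close>)
    then obtain y where y: "y \<in> {-\<delta>..\<delta>}" and min: "\<And>x. x \<in> {-\<delta>..\<delta>} \<Longrightarrow> v t y ^ 4 \<le> v t x ^ 4"
      by blast
    let ?h = "\<lambda>x. K x * v t x ^ 4"
    have ch: "continuous_on UNIV ?h" by (intro continuous_intros)
    have "v t y ^ 4 * (K 0 * \<delta>) = oint (-\<delta>) \<delta> (\<lambda>_. K 0 / 2 * v t y ^ 4)"
      by (simp add: oint_const)
    also have "\<dots> \<le> oint (-\<delta>) \<delta> ?h"
    proof (rule oint_mono)
      fix x assume x: "x \<in> {-\<delta>..\<delta>}"
      then have "K 0 / 2 \<le> K x" by (intro K_low) auto
      then show "K 0 / 2 * v t y ^ 4 \<le> K x * v t x ^ 4"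
        by (rule mult_mono[OF _ min[OF x] K_nonneg]) simp
    qed (use \<delta> ch in auto)
    also have "\<dots> \<le> I ?h"
    proof -
      have "0 \<le> oint (- 1) (-\<delta>) ?h" "0 \<le> oint \<delta> 1 ?h"
        using \<delta> by (auto intro!: oint_nonneg ch mult_nonneg_nonneg K_nonneg)
      then show ?thesis
        using oint_split[OF ch, of "-\<delta>" \<delta> "- 1"] oint_split[OF ch, of \<delta> 1 "- 1"] by linarith
    qed
    also have "\<dots> \<le> energy t"
      using energy_terms_nonneg[of t] by (simp add: energy_def)
    finally have "v t y ^ 4 \<le> 1 / (K 0 * \<delta>) * energy t"
      using K_pos \<delta> by (simp add: field_simps)
    then show "\<exists>y\<in>{-1..1}. v t y ^ 4 \<le> 1 / (K 0 * \<delta>) * energy t"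
      using y \<delta> by (intro bexI[of _ y]) auto
  qed
qed

lemma v_le_energy:
  assumes "0 < \<epsilon>" "-1 \<le> y" "y \<le> 1" "-1 \<le> x" "x \<le> 1"
  shows "\<bar>v t x\<bar> \<le> \<bar>v t y\<bar> + \<epsilon> + energy t / \<epsilon>"
  using v_oscillation_le[of \<epsilon> y x t] v_oscillation_le[of \<epsilon> x y t] assms
  by (cases "y \<le> x") auto

lemma v_bounded:
  obtains V where "0 \<le> V" "\<And>t x. T0 + 1 \<le> t \<Longrightarrow> \<bar>x\<bar> \<le> 1 \<Longrightarrow> \<bar>v t x\<bar> \<le> V"
proof -
  obtain C where C: "0 < C" "\<And>t. \<exists>y\<in>{-1..1}. v t y ^ 4 \<le> C * energy t"
    using v_small_somewhere by blast
  let ?e = "energy (T0 + 1)"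
  show ?thesis
  proof
    show "0 \<le> 1 + C * ?e + 1 + ?e" using C(1) energy_nonneg[of "T0 + 1"] by simp
    fix t x assume t: "T0 + 1 \<le> t" and x: "\<bar>x\<bar> \<le> (1 :: real)"
    have e: "energy t \<le> ?e" using t by (intro energy_antimono) auto
    obtain y where y: "y \<in> {-1..1}" "v t y ^ 4 \<le> C * energy t" using C(2) by blast
    have "\<bar>v t y\<bar> \<le> 1 + v t y ^ 4"
    proof (cases "\<bar>v t y\<bar> \<le> 1")
      case False
      then have "\<bar>v t y\<bar> ^ 1 \<le> \<bar>v t y\<bar> ^ 4" by (intro power_increasing) auto
      then show ?thesis by simp
    qed (simp add: add_increasing2)
    also have "v t y ^ 4 \<le> C * ?e"
      using y(2) mult_left_mono[OF e, of C] C(1) by linarith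
    finally have "\<bar>v t y\<bar> \<le> 1 + C * ?e" by simp
    moreover have "\<bar>v t x\<bar> \<le> \<bar>v t y\<bar> + 1 + energy t / 1"
      by (rule v_le_energy) (use x y(1) in auto)
    ultimately show "\<bar>v t x\<bar> \<le> 1 + C * ?e + 1 + ?e" using e by simp
  qed
qed

lemma morawetz_bounded_below:
  obtains B where "0 \<le> B" "\<And>t. T0 + 1 \<le> t \<Longrightarrow> - B \<le> morawetz t + energy t"
proof -
  obtain V where V: "0 \<le> V" "\<And>t x. T0 + 1 \<le> t \<Longrightarrow> \<bar>x\<bar> \<le> 1 \<Longrightarrow> \<bar>v t x\<bar> \<le> V"
    using v_bounded by blast
  have weight: "- I (\<lambda>x. f x ^ 2) \<le> I (\<lambda>x. x * f x ^ 2)" "I (\<lambda>x. x * f x ^ 2) \<le> I (\<lambda>x. f x ^ 2)"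
    if [continuous_intros]: "continuous_on UNIV f" for f
  proof -
    have "I (\<lambda>x. - (f x ^ 2)) \<le> I (\<lambda>x. x * f x ^ 2)"
    proof (rule oint_mono)
      fix x :: real assume "x \<in> {-1..1}"
      then show "- (f x ^ 2) \<le> x * f x ^ 2" using mult_right_mono[of "-1" x "f x ^ 2"] by auto
    qed (intro continuous_intros | simp)+
    then show "- I (\<lambda>x. f x ^ 2) \<le> I (\<lambda>x. x * f x ^ 2)" by (simp add: oint_uminus)
    show "I (\<lambda>x. x * f x ^ 2) \<le> I (\<lambda>x. f x ^ 2)"
    proof (rule oint_mono)
      fix x :: real assume "x \<in> {-1..1}"
      then show "x * f x ^ 2 \<le> f x ^ 2" using mult_right_mono[of x 1 "f x ^ 2"] by auto
    qed (intro continuous_intros | simp)+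
  qed
  have cross: "- (V\<^sup>2 + I (\<lambda>x. f x ^ 2) / 2) \<le> I (\<lambda>x. v t x * f x)"
    if [continuous_intros]: "continuous_on UNIV f" and t: "T0 + 1 \<le> t" for f t
  proof -
    have "I (\<lambda>x. - V\<^sup>2 / 2 + (- 1 / 2) * f x ^ 2) \<le> I (\<lambda>x. v t x * f x)"
    proof (rule oint_mono)
      fix x :: real assume "x \<in> {-1..1}"
      then have "\<bar>v t x\<bar> \<le> V" using V(2)[OF t, of x] by auto
      then have "(v t x)\<^sup>2 \<le> V\<^sup>2" by (rule power2_le_iff_abs_le[OF V(1), THEN iffD2])
      moreover have "0 \<le> (v t x + f x)\<^sup>2" by simp
      ultimately show "- V\<^sup>2 / 2 + (- 1 / 2) * f x ^ 2 \<le> v t x * f x"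
        by (simp add: power2_sum)
    qed (intro continuous_intros | simp)+
    also have "I (\<lambda>x. - V\<^sup>2 / 2 + (- 1 / 2) * f x ^ 2) = - (V\<^sup>2 + I (\<lambda>x. f x ^ 2) / 2)"
    proof -
      have "I (\<lambda>x. - V\<^sup>2 / 2 + (- 1 / 2) * f x ^ 2) = I (\<lambda>x. - V\<^sup>2 / 2) + I (\<lambda>x. (- 1 / 2) * f x ^ 2)"
        by (rule oint_add; intro continuous_intros)
      then show ?thesis by (simp only: oint_cmult oint_const) simp
    qed
    finally show ?thesis .
  qed
  show ?thesis
  proof
    show "0 \<le> 2 * V\<^sup>2 + energy (T0 + 1)" using energy_nonneg[of "T0 + 1"] by simp
    fix t assume t: "T0 + 1 \<le> t"
    have c: "continuous_on UNIV (p t)" "continuous_on UNIV (q t)"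
      by (intro continuous_intros)+
    have "energy t \<le> energy (T0 + 1)" using t by (intro energy_antimono) auto
    moreover have "0 \<le> v t 1 ^ 2 + v t (- 1) ^ 2" by simp
    ultimately show "- (2 * V\<^sup>2 + energy (T0 + 1)) \<le> morawetz t + energy t"
      using weight[OF c(1)] weight[OF c(2)] cross[OF c(1) t] cross[OF c(2) t] energy_terms_nonneg[of t]
        zero_le_power2[of V]
      unfolding morawetz_def energy_def by argo
  qed
qed

lemma energy_decay:
  assumes "0 < \<eta>"
  obtains T where "T0 + 1 \<le> T" "\<And>t. T \<le> t \<Longrightarrow> energy t \<le> \<eta>"
proof -
  obtain B where B: "0 \<le> B" "\<And>t. T0 + 1 \<le> t \<Longrightarrow> - B \<le> morawetz t + energy t"
    using morawetz_bounded_below by blast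
  let ?T = "T0 + 1" and ?Z = "\<lambda>t. morawetz t + energy t"
  define M where "M = ?Z ?T + B"
  have M: "0 \<le> M" using B(2)[of ?T] by (simp add: M_def)
  have decay: "(t - ?T) * energy t \<le> 4 * M" if t: "?T \<le> t" for t
  proof -
    \<comment> \<open>Up to time \<open>t\<close> the energy is at least \<open>energy t\<close>, so \<open>?Z\<close> decreases at least at the rate \<open>energy t / 4\<close>.\<close>
    have "?Z t + t * (energy t / 4) \<le> ?Z ?T + ?T * (energy t / 4)"
    proof (rule DERIV_nonpos_imp_nonincreasing[OF t])
      fix r assume r: "?T \<le> r" "r \<le> t"
      obtain D where D: "(?Z has_real_derivative D) (at r)" "D \<le> - energy r / 4"
        by (rule deriv_morawetz[of r]) (use r in auto)
      have "energy t \<le> energy r" using r by (intro energy_antimono) auto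
      then have "D + 1 * (energy t / 4) \<le> 0" using D(2) by simp
      moreover have "((\<lambda>r. ?Z r + r * (energy t / 4)) has_real_derivative D + 1 * (energy t / 4)) (at r)"
        by (intro DERIV_add D(1) DERIV_cmult_right DERIV_ident)
      ultimately show "\<exists>y. ((\<lambda>r. ?Z r + r * (energy t / 4)) has_real_derivative y) (at r) \<and> y \<le> 0"
        by blast
    qed
    then show ?thesis using B(2)[OF t] by (simp add: M_def field_simps)
  qed
  show ?thesis
  proof
    show "?T \<le> ?T + (4 * M + 1) / \<eta>" using M assms by simp
    fix t assume t: "?T + (4 * M + 1) / \<eta> \<le> t"
    have pos: "0 < (4 * M + 1) / \<eta>" using M assms by simp
    show "energy t \<le> \<eta>"
    proof (rule ccontr)
      assume "\<not> energy t \<le> \<eta>"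
      then have "(4 * M + 1) / \<eta> * \<eta> \<le> (t - ?T) * energy t"
        using t pos assms by (intro mult_mono) auto
      then show False using decay[of t] t pos assms by auto
    qed
  qed
qed

lemma v_decay_unit_interval:
  assumes "0 < \<eta>"
  obtains T where "T0 + 1 \<le> T" "\<And>t x. T \<le> t \<Longrightarrow> \<bar>x\<bar> \<le> 1 \<Longrightarrow> \<bar>v t x\<bar> \<le> \<eta>"
proof -
  obtain C where C: "0 < C" "\<And>t. \<exists>y\<in>{-1..1}. v t y ^ 4 \<le> C * energy t"
    using v_small_somewhere by blast
  define h where "h = min ((\<eta> / 2) ^ 4 / C) ((\<eta> / 4)\<^sup>2)"
  have "0 < h" using assms C(1) by (simp add: h_def)
  then obtain T where T: "T0 + 1 \<le> T" "\<And>t. T \<le> t \<Longrightarrow> energy t \<le> h"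
    using energy_decay by blast
  show ?thesis
  proof
    show "T0 + 1 \<le> T" by fact
    fix t x assume t: "T \<le> t" and x: "\<bar>x\<bar> \<le> (1 :: real)"
    have e: "energy t \<le> (\<eta> / 2) ^ 4 / C" "energy t \<le> (\<eta> / 4)\<^sup>2"
      using T(2)[OF t] by (auto simp: h_def)
    obtain y where y: "y \<in> {-1..1}" "v t y ^ 4 \<le> C * energy t" using C(2) by blast
    have "\<bar>v t y\<bar> ^ 4 \<le> (\<eta> / 2) ^ 4"
      using y(2) e(1) C(1) by (simp add: field_simps)
    then have "\<bar>v t y\<bar> \<le> \<eta> / 2"
      by (rule power_le_imp_le_base[of _ 3, simplified]) (use assms in auto)
    moreover have "energy t / (\<eta> / 4) \<le> \<eta> / 4"
      using e(2) assms by (simp add: field_simps power2_eq_square)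
    moreover have "\<bar>v t x\<bar> \<le> \<bar>v t y\<bar> + \<eta> / 4 + energy t / (\<eta> / 4)"
      by (rule v_le_energy) (use x y(1) assms in auto)
    ultimately show "\<bar>v t x\<bar> \<le> \<eta>" by linarith
  qed
qed

lemma v_decay:
  assumes "0 < \<eta>"
  obtains T where "\<And>t x. T \<le> t \<Longrightarrow> \<bar>x\<bar> \<le> R \<Longrightarrow> \<bar>v t x\<bar> \<le> \<eta>"
proof -
  obtain T where T: "T0 + 1 \<le> T" "\<And>t x. T \<le> t \<Longrightarrow> \<bar>x\<bar> \<le> 1 \<Longrightarrow> \<bar>v t x\<bar> \<le> \<eta>"
    using v_decay_unit_interval[OF assms] by blast
  show ?thesis
  proof (rule that[of "T + \<bar>R\<bar>"])
    fix t x assume t: "T + \<bar>R\<bar> \<le> t" and x: "\<bar>x\<bar> \<le> R"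
    have T0: "0 \<le> T" using T(1) T0_nonneg by simp
    consider "\<bar>x\<bar> \<le> 1" | "1 \<le> x" | "x \<le> - 1" by linarith
    then show "\<bar>v t x\<bar> \<le> \<eta>"
    proof cases
      case 1
      then show ?thesis using T(2)[of t x] t by auto
    next
      case 2
      then show ?thesis using T(2)[of "t - (x - 1)" 1] v_outgoing_right[of x t] t x T0 by auto
    next
      case 3
      then show ?thesis using T(2)[of "t - (- x - 1)" "- 1"] v_outgoing_left[of x t] t x T0 by auto
    qed
  qed
qed

end

section \<open>Smooth functions and a vanishing criterion\<close>

lemma smooth_iff: "smooth f \<longleftrightarrow> (\<forall>x. f differentiable (at x)) \<and> smooth (deriv f)"
  (is "?l = ?r")
proof
  assume l: ?l
  have "(deriv ^^ n) (deriv f) = (deriv ^^ Suc n) f" for n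
    by (simp add: funpow_swap1)
  then show ?r using l unfolding smooth_def by (metis funpow_0)
next
  assume r: ?r
  have "(deriv ^^ n) f differentiable (at x)" for n x
  proof (cases n)
    case (Suc m)
    have "(deriv ^^ Suc m) f = (deriv ^^ m) (deriv f)" by (simp add: funpow_swap1)
    then show ?thesis using r Suc unfolding smooth_def by metis
  qed (use r in auto)
  then show ?l by (simp add: smooth_def)
qed

lemma smooth_has_deriv: "smooth f \<Longrightarrow> (f has_real_derivative deriv f x) (at x)"
  using smooth_iff[of f] DERIV_deriv_iff_real_differentiable[of f x] by blast

lemma smooth_continuous: "smooth f \<Longrightarrow> continuous_on A f"
  using smooth_has_deriv DERIV_isCont continuous_at_imp_continuous_on by metis

lemma smooth_if_deriv:
  assumes "\<And>x. (f has_real_derivative f' x) (at x)" "smooth f'"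
  shows "smooth f"
proof -
  have "deriv f = f'" using assms(1) DERIV_imp_deriv by blast
  then show ?thesis using assms smooth_iff[of f] real_differentiable_def by blast
qed

lemma smooth_lincomb:
  assumes "smooth f" "smooth g"
  shows "smooth (\<lambda>x. a * f x + b * g x)"
proof -
  have deriv: "((deriv ^^ n) f has_real_derivative (deriv ^^ Suc n) f x) (at x)"
    "((deriv ^^ n) g has_real_derivative (deriv ^^ Suc n) g x) (at x)" for n x
    using assms by (auto simp: smooth_def DERIV_deriv_iff_real_differentiable)
  have d: "((\<lambda>x. a * (deriv ^^ n) f x + b * (deriv ^^ n) g x) has_real_derivative
      a * (deriv ^^ Suc n) f x + b * (deriv ^^ Suc n) g x) (at x)" for n x
    by (intro DERIV_add DERIV_cmult deriv)
  have "(deriv ^^ n) (\<lambda>x. a * f x + b * g x) = (\<lambda>x. a * (deriv ^^ n) f x + b * (deriv ^^ n) g x)" for n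
  proof (induction n)
    case (Suc n)
    then show ?case using DERIV_imp_deriv[OF d[of n]] by auto
  qed simp
  then show ?thesis
    unfolding smooth_def using d real_differentiable_def by metis
qed

lemma smooth_affine:
  assumes "smooth f"
  shows "smooth (\<lambda>x. f (a * x + b))"
proof -
  have deriv: "((deriv ^^ n) f has_real_derivative (deriv ^^ Suc n) f x) (at x)" for n x
    using assms by (auto simp: smooth_def DERIV_deriv_iff_real_differentiable)
  have lin: "((\<lambda>x. a * x + b) has_real_derivative a) (at x)" for x
    by (auto intro!: derivative_eq_intros)
  have d: "((\<lambda>x. a ^ n * (deriv ^^ n) f (a * x + b)) has_real_derivative
      a ^ Suc n * (deriv ^^ Suc n) f (a * x + b)) (at x)" for n x
    using DERIV_cmult[OF DERIV_chain2[OF deriv lin], of "a ^ n" n x] by (simp add: algebra_simps)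
  have "(deriv ^^ n) (\<lambda>x. f (a * x + b)) = (\<lambda>x. a ^ n * (deriv ^^ n) f (a * x + b))" for n
  proof (induction n)
    case (Suc n)
    then show ?case using DERIV_imp_deriv[OF d[of n]] by auto
  qed simp
  then show ?thesis
    unfolding smooth_def using d real_differentiable_def by metis
qed

lemma AE_zero_if_halfline_integrals_zero:
  fixes D :: "real \<Rightarrow> real"
  assumes D: "integrable lborel D" and zero: "\<And>a. (LBINT x:{..a}. D x) = 0"
  shows "AE x in lborel. D x = 0"
proof -
  have set_int: "set_integrable lborel A D" if "A \<in> sets borel" for A
    using that integrable_mult_indicator[OF _ D, of A] by (simp add: set_integrable_def)
  have "((\<lambda>a. LBINT x:{..a}. D x) \<longlongrightarrow> (LBINT x. D x)) at_top"
    unfolding set_lebesgue_integral_def by (rule tendsto_integral_at_top) (use D in auto)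
  then have all: "(LBINT x. D x) = 0"
    unfolding zero using tendsto_const_iff by (metis trivial_limit_at_top_linorder)
  have "(LBINT x:A. D x) = 0" if "A \<in> sets borel" for A
  proof -
    have "Int_stable (range (atMost :: real \<Rightarrow> real set))"
      unfolding Int_stable_def by (auto intro: rangeI simp: Int_atMost)
    moreover have "range (atMost :: real \<Rightarrow> real set) \<subseteq> Pow UNIV" by simp
    moreover have "A \<in> sigma_sets UNIV (range atMost)"
      using that borel_eq_atMost[where 'a = real] by (metis sets_measure_of subset_UNIV Pow_UNIV)
    ultimately show ?thesis
    proof (induction rule: sigma_sets_induct_disjoint)
      case (basic A) then show ?case using zero by auto
    next
      case empty then show ?case by (simp add: set_lebesgue_integral_def)
    next
      case (compl A)
      then have A: "A \<in> sets borel" by (simp add: borel_eq_atMost)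
      have "(LBINT x:A \<union> (UNIV - A). D x) = (LBINT x:A. D x) + (LBINT x:(UNIV - A). D x)"
        by (rule set_integral_Un) (use A set_int in auto)
      then show ?case using compl(2) all by (simp add: set_lebesgue_integral_def)
    next
      case (union A)
      then have A: "A i \<in> sets borel" for i by (auto simp: borel_eq_atMost)
      have "(LBINT x:(\<Union>i. A i). D x) = (\<Sum>i. (LBINT x:(A i). D x))"
        using union A by (intro lebesgue_integral_countable_add set_int)
          (auto simp: disjoint_family_on_def)
      then show ?case using union by simp
    qed
  qed
  then show ?thesis
    using density_unique_real[OF D, of "\<lambda>_. 0"] by (simp add: set_lebesgue_integral_def)
qed

text \<open>
  Integration by parts for primitives, in the form of an exchange of the order of integration over
  the half-plane \<open>y \<le> x\<close>.
\<close>

lemma Fubini_triangle: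
  fixes g h :: "real \<Rightarrow> real"
  assumes g: "integrable lborel g" and h: "integrable lborel h"
  shows "(LBINT x. h x * (LBINT y:{..x}. g y)) = (LBINT y. g y * (LBINT x:{y..}. h x))"
proof -
  have [measurable]: "g \<in> borel_measurable borel" "h \<in> borel_measurable borel"
    using g h by auto
  define H where "H x y = h x * g y * indicator {p. snd p \<le> fst p} (x, y)" for x y :: real
  have "closed {p :: real \<times> real. snd p \<le> fst p}"
    by (intro closed_Collect_le continuous_intros)
  then have triangle: "{p :: real \<times> real. snd p \<le> fst p} \<in> sets (borel \<Otimes>\<^sub>M borel)"
    unfolding borel_prod by (rule borel_closed)
  have prod: "integrable (lborel \<Otimes>\<^sub>M lborel) (\<lambda>(x, y). h x * g y)"
  proof (rule lborel_pair.Fubini_integrable)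
    show "integrable lborel (\<lambda>x. LBINT y. norm (case (x, y) of (x, y) \<Rightarrow> h x * g y))"
      using h by (simp add: abs_mult)
  qed (use g in auto)
  have "integrable (lborel \<Otimes>\<^sub>M lborel) (\<lambda>z. indicator {p. snd p \<le> fst p} z *\<^sub>R (case z of (x, y) \<Rightarrow> h x * g y))"
    by (rule integrable_mult_indicator[OF _ prod]) (simp add: triangle)
  moreover have "(\<lambda>z. indicator {p. snd p \<le> fst p} z *\<^sub>R (case z of (x, y) \<Rightarrow> h x * g y)) = case_prod H"
    by (rule ext) (simp add: H_def split: prod.split)
  ultimately have H: "integrable (lborel \<Otimes>\<^sub>M lborel) (case_prod H)" by simp
  have "(LBINT x. h x * (LBINT y:{..x}. g y)) = (LBINT x. LBINT y. H x y)"
    unfolding set_lebesgue_integral_def H_def integral_mult_right_zero[symmetric]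
    by (intro Bochner_Integration.integral_cong refl) (auto simp: indicator_def)
  also have "\<dots> = (LBINT y. LBINT x. H x y)"
    using lborel_pair.Fubini_integral[OF H] by simp
  also have "\<dots> = (LBINT y. g y * (LBINT x:{y..}. h x))"
    unfolding set_lebesgue_integral_def H_def integral_mult_right_zero[symmetric]
    by (intro Bochner_Integration.integral_cong refl) (auto simp: indicator_def)
  finally show ?thesis .
qed

lemma oint_eq_set_integral:
  assumes "continuous_on {a..b} f" "a \<le> b"
  shows "oint a b f = (LBINT x:{a..b}. f x)"
  using oint_eq_integral[OF assms] set_borel_integral_eq_integral(2)[OF borel_integrable_atLeastAtMost'[OF assms(1)]]
  by simp

lemma oint_swap: "continuous_on UNIV f \<Longrightarrow> oint a b f = - oint b a f"
  using oint_split[of f a b b] by simp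

lemma L2_set_integrable:
  assumes "f \<in> L2"
  shows "integrable lborel (\<lambda>x. indicator {-1..1} x * f x)"
proof (rule Bochner_Integration.integrable_bound)
  show "integrable lborel (\<lambda>x. indicator {-1..1::real} x + (f x)\<^sup>2)"
    using assms by (intro Bochner_Integration.integrable_add) (auto simp: L2_def)
  show "(\<lambda>x. indicator {-1..1} x * f x) \<in> borel_measurable lborel"
    using assms by (auto simp: L2_def)
  have "\<bar>f x\<bar> \<le> 1 + (f x)\<^sup>2" for x
  proof -
    have "0 \<le> (\<bar>f x\<bar> - 1)\<^sup>2" by simp
    then have "2 * \<bar>f x\<bar> \<le> 1 + (f x)\<^sup>2" by (simp add: power2_diff)
    then show ?thesis using abs_ge_zero[of "f x"] by linarith
  qed
  then show "AE x in lborel. norm (indicator {-1..1} x * f x) \<le> norm (indicator {-1..1::real} x + (f x)\<^sup>2)"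
    by (auto simp: indicator_def abs_mult)
qed

section \<open>Weak derivatives have primitives\<close>

text \<open>
  A primitive of \<open>g\<close> on \<open>[-1, 1]\<close>. The truncation makes \<open>g\<close> integrable when it is
  merely square integrable.
\<close>

definition local_primitive :: "(real \<Rightarrow> real) \<Rightarrow> real \<Rightarrow> real" where
  "local_primitive g x = (LBINT y:{..x}. indicator {-1..1} y * g y)"

lemma local_primitive_diff:
  assumes "g \<in> L2" "x \<le> y"
  shows "local_primitive g y - local_primitive g x = (LBINT z:{x<..y}. indicator {-1..1} z * g z)"
proof -
  have int: "set_integrable lborel A (\<lambda>z. indicator {-1..1} z * g z)" if "A \<in> sets borel" for A
    using integrable_mult_indicator[OF _ L2_set_integrable[OF assms(1)], of A] that
    by (simp add: set_integrable_def)
  have "{..y} = {..x} \<union> {x<..y}" using assms(2) by auto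
  then show ?thesis
    unfolding local_primitive_def
    by (subst \<open>{..y} = _\<close>, subst set_integral_Un) (auto intro!: int)
qed

lemma continuous_local_primitive:
  assumes "g \<in> L2"
  shows "continuous_on UNIV (local_primitive g)"
proof -
  let ?g = "\<lambda>y. indicator {-1..1} y * g y :: real"
  have [measurable]: "g \<in> borel_measurable borel"
    using assms by (simp add: L2_def)
  have "isCont (local_primitive g) x" for x
    unfolding isCont_def tendsto_at_iff_sequentially comp_def local_primitive_def
      set_lebesgue_integral_def
  proof (intro allI impI, rule integral_dominated_convergence)
    fix X assume X: "\<forall>i. X i \<in> UNIV - {x}" "X \<longlonglongrightarrow> x"
    have "((\<lambda>s. indicator {..s} y *\<^sub>R ?g y) \<longlongrightarrow> indicator {..x} y *\<^sub>R ?g y) (at x)" if "y \<noteq> x" for y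
    proof (rule tendsto_eventually)
      have "\<forall>\<^sub>F s in at x. y < s \<longleftrightarrow> y < x"
      proof (cases "y < x")
        case True
        then show ?thesis using order_tendstoD(1)[OF tendsto_ident_at, of y x UNIV] by simp
      next
        case False
        then have "\<forall>\<^sub>F s in at x. s < y" using that order_tendstoD(2)[OF tendsto_ident_at, of x y UNIV] by simp
        then show ?thesis by eventually_elim (use False in auto)
      qed
      moreover have "\<forall>\<^sub>F s in at x. s \<noteq> y"
        using that by (intro eventually_neq_at_within)
      ultimately show "\<forall>\<^sub>F s in at x. indicator {..s} y *\<^sub>R ?g y = indicator {..x} y *\<^sub>R ?g y"
        by eventually_elim (use that in \<open>auto simp: indicator_def\<close>)
    qed
    moreover have "filterlim X (at x) sequentially"
      using X by (simp add: filterlim_at)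
    ultimately have "(\<lambda>n. indicator {..X n} y *\<^sub>R ?g y) \<longlonglongrightarrow> indicator {..x} y *\<^sub>R ?g y" if "y \<noteq> x" for y
      using that filterlim_compose by blast
    then show "AE y in lborel. (\<lambda>n. indicator {..X n} y *\<^sub>R ?g y) \<longlonglongrightarrow> indicator {..x} y *\<^sub>R ?g y"
      using AE_lborel_singleton[of x] by (auto elim!: AE_mp)
    show "integrable lborel (\<lambda>y. \<bar>?g y\<bar>)"
      using L2_set_integrable[OF assms] by auto
  qed (auto simp: indicator_def)
  then show ?thesis by (simp add: continuous_at_imp_continuous_on)
qed

lemma admissible_facts:
  assumes "admissible K"
  shows "smooth K" "0 \<le> K x" "1 \<le> \<bar>x\<bar> \<Longrightarrow> K x = 0" "0 < K 0" "x * deriv K x \<le> 0"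
proof -
  show sm: "smooth K" and "0 \<le> K x" and "0 < K 0" and "x * deriv K x \<le> 0"
    using assms unfolding admissible_def by blast+
  have out: "K y = 0" if "1 < \<bar>y\<bar>" for y
  proof (rule ccontr)
    assume "K y \<noteq> 0"
    then have "y \<in> supp K"
      unfolding supp_def by (intro subsetD[OF closure_subset]) simp
    moreover have "supp K \<subseteq> {-1..1}" using assms by (simp add: admissible_def)
    ultimately show False using that by (auto simp: subset_iff abs_le_iff)
  qed
  have closed: "closed {y. K y = 0}"
    by (intro closed_Collect_eq smooth_continuous[OF sm] continuous_intros)
  have "{1<..} \<subseteq> {y. K y = 0}" "{..< -1} \<subseteq> {y. K y = 0}"
    using out by auto
  from this[THEN closure_minimal, OF closed] show "K x = 0" if "1 \<le> \<bar>x\<bar>"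
    using that by (cases "0 \<le> x") auto
qed

lemma primitive_vs_test:
  assumes g: "g \<in> L2" and "smooth \<psi>" and out: "\<And>x. 1 \<le> \<bar>x\<bar> \<Longrightarrow> \<psi> x = 0"
  shows "(LBINT x. g x * \<psi> x) = - (LBINT x. indicator {-1..1} x * deriv \<psi> x * local_primitive g x)"
proof -
  let ?g = "\<lambda>y. indicator {-1..1} y * g y" and ?h = "\<lambda>x. indicator {-1..1} x * deriv \<psi> x"
  have ch: "continuous_on UNIV (deriv \<psi>)"
    using assms(2) smooth_iff[of \<psi>] smooth_continuous by blast
  have "set_integrable lborel {-1..1} (deriv \<psi>)"
    by (rule borel_integrable_atLeastAtMost') (rule continuous_on_subset[OF ch], simp)
  then have h: "integrable lborel ?h" by (simp add: set_integrable_def)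
  have tail: "?g y * (LBINT x:{y..}. ?h x) = - (g y * \<psi> y)" for y
  proof (cases "y \<in> {-1..1}")
    case True
    have "(LBINT x:{y..}. ?h x) = (LBINT x:{y..1}. deriv \<psi> x)"
      unfolding set_lebesgue_integral_def
      using True by (intro Bochner_Integration.integral_cong) (auto simp: indicator_def)
    also have "\<dots> = oint y 1 (deriv \<psi>)"
      using True by (subst oint_eq_set_integral) (auto intro: continuous_on_subset[OF ch])
    also have "\<dots> = \<psi> 1 - \<psi> y"
      by (rule oint_FTC) (rule smooth_has_deriv[OF assms(2)])
    finally show ?thesis using True out[of 1] by simp
  next
    case False
    then show ?thesis using out[of y] by auto
  qed
  show ?thesis
    using Fubini_triangle[OF L2_set_integrable[OF g] h]
    unfolding tail local_primitive_def by simp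
qed

text \<open>
  The lemma of du Bois-Reymond. Let \<open>G\<close> be the primitive of \<open>g\<close>. Subtracting a multiple of \<open>K\<close>
  from a smooth \<open>\<phi>\<close> supported in \<open>[-1, 1]\<close> makes its integral vanish, so the difference is the
  derivative of a test function. Hence the integral of \<open>(f - G) \<phi>\<close> is a fixed
  multiple \<open>c\<close> of that of \<open>\<phi>\<close>. Taking smooth approximations of indicator functions of
  intervals for \<open>\<phi>\<close>, one finds that \<open>f - G - c\<close> has integral zero over every interval
  \<open>(-1, b)\<close> with \<open>b \<le> 1\<close>.
\<close>

lemma weak_derivative_primitive:
  assumes K: "admissible K" and f: "f \<in> L2" and g: "g \<in> L2" and weak: "weak_derivative f g"
  obtains c where "AE x in lborel. -1 < x \<and> x < 1 \<longrightarrow> f x = c + local_primitive g x"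
proof -
  note K = admissible_facts[OF K]
  have cK: "continuous_on A K" for A by (rule smooth_continuous[OF K(1)])
  define \<theta> where "\<theta> y = oint (-1) y K" for y
  define \<kappa> where "\<kappa> = \<theta> 1"
  have \<theta>_deriv: "(\<theta> has_real_derivative K y) (at y)" for y
    unfolding \<theta>_def by (rule oint_deriv[OF cK])
  have sm_\<theta>: "smooth \<theta>" by (rule smooth_if_deriv[OF \<theta>_deriv K(1)])
  have \<theta>_mono: "\<theta> x \<le> \<theta> y" if "x \<le> y" for x y
    by (rule DERIV_nonneg_imp_nondecreasing[OF that]) (use \<theta>_deriv K(2) in blast)
  have outside: "oint a b \<phi> = 0" if "\<And>x. 1 \<le> \<bar>x\<bar> \<Longrightarrow> \<phi> x = 0" "a \<le> b" "b \<le> -1 \<or> 1 \<le> a" for a b \<phi>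
    using oint_cong[OF that(2), of \<phi> "\<lambda>_. 0"] that by (auto simp: oint_const)
  have \<theta>_left: "\<theta> y = 0" if "y \<le> -1" for y
    using outside[OF K(3) that] oint_swap[OF cK, of "-1" y] by (simp add: \<theta>_def)
  have \<theta>_right: "\<theta> y = \<kappa>" if "1 \<le> y" for y
    using outside[OF K(3) that] oint_split[OF cK, of 1 y "-1"] by (simp add: \<theta>_def \<kappa>_def)
  have \<theta>_range: "0 \<le> \<theta> y" "\<theta> y \<le> \<kappa>" for y
    using \<theta>_mono[of "min y (-1)" y] \<theta>_mono[of y "max y 1"] \<theta>_left[of "min y (-1)"] \<theta>_right[of "max y 1"]
    by auto
  have \<kappa>: "0 < \<kappa>"
  proof (rule ccontr)
    assume "\<not> 0 < \<kappa>"
    have "\<theta> y = 0" for y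
      using \<theta>_range[of y] \<open>\<not> 0 < \<kappa>\<close> by linarith
    then have "((\<lambda>_. 0) has_real_derivative K 0) (at 0)"
      using \<theta>_deriv[of 0] by (simp add: fun_eq_iff[symmetric] ext[of \<theta> "\<lambda>_. 0"])
    then have "K 0 = 0" using DERIV_unique[OF _ DERIV_const] by blast
    then show False using K(4) by simp
  qed
  let ?G = "local_primitive g"
  have cG: "continuous_on A ?G" for A
    using continuous_local_primitive[OF g] continuous_on_subset by blast
  define E where "E x = indicator {-1..1} x * (f x - ?G x)" for x
  have E: "integrable lborel E"
  proof -
    have "set_integrable lborel {-1..1} ?G"
      by (rule borel_integrable_atLeastAtMost'[OF cG])
    then have "integrable lborel (\<lambda>x. indicator {-1..1} x * ?G x)" by (simp add: set_integrable_def)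
    from Bochner_Integration.integrable_diff[OF L2_set_integrable[OF f] this]
    show ?thesis by (simp add: E_def[abs_def] algebra_simps)
  qed
  define c where "c = (LBINT x. E x * K x) / \<kappa>"
  define D where "D x = E x - c * indicator {-1..1} x" for x
  have D: "integrable lborel D"
    unfolding D_def by (intro Bochner_Integration.integrable_diff E integrable_mult_right) simp
  have int_mult: "integrable lborel (\<lambda>x. E x * \<phi> x)" if "continuous_on UNIV \<phi>" for \<phi>
  proof -
    have "compact (\<phi> ` {-1..1})"
      by (intro compact_continuous_image compact_Icc continuous_on_subset[OF that]) simp
    from compact_imp_bounded[OF this] obtain M where M: "\<And>x. x \<in> {-1..1} \<Longrightarrow> \<bar>\<phi> x\<bar> \<le> M"
      unfolding bounded_iff by (metis imageI real_norm_def)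
    have [measurable]: "\<phi> \<in> borel_measurable borel" "E \<in> borel_measurable borel"
      using that E by (auto intro: borel_measurable_continuous_onI)
    show ?thesis
    proof (rule Bochner_Integration.integrable_bound)
      show "integrable lborel (\<lambda>x. M * \<bar>E x\<bar>)" using E by simp
      have "\<bar>E x * \<phi> x\<bar> \<le> M * \<bar>E x\<bar>" for x
        using M[of x] mult_right_mono[of "\<bar>\<phi> x\<bar>" M "\<bar>E x\<bar>"]
        by (cases "x \<in> {-1..1}") (auto simp: E_def abs_mult mult.commute)
      then show "AE x in lborel. norm (E x * \<phi> x) \<le> norm (M * \<bar>E x\<bar>)"
        by (intro AE_I2) (metis abs_ge_self order_trans real_norm_def)
    qed simp
  qed
  have int_ind: "integrable lborel (\<lambda>x. indicator {-1..1} x * \<phi> x)"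
    "(LBINT x. indicator {-1..1} x * \<phi> x) = oint (-1) 1 \<phi>"
    if "continuous_on UNIV \<phi>" for \<phi> :: "real \<Rightarrow> real"
  proof -
    have c: "continuous_on {-1..1} \<phi>" using that continuous_on_subset by blast
    show "integrable lborel (\<lambda>x. indicator {-1..1} x * \<phi> x)"
      using borel_integrable_atLeastAtMost'[OF c] by (simp add: set_integrable_def)
    show "(LBINT x. indicator {-1..1} x * \<phi> x) = oint (-1) 1 \<phi>"
      using oint_eq_set_integral[OF c] by (simp add: set_lebesgue_integral_def)
  qed
  have test: "(LBINT x. D x * \<phi> x) = 0"
    if sm: "smooth \<phi>" and out: "\<And>x. 1 \<le> \<bar>x\<bar> \<Longrightarrow> \<phi> x = 0" for \<phi>
  proof -
    have c\<phi>: "continuous_on A \<phi>" for A by (rule smooth_continuous[OF sm])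
    define m where "m = oint (-1) 1 \<phi> / \<kappa>"
    define \<psi> where "\<psi> y = oint (-1) y \<phi> - m * \<theta> y" for y
    have \<psi>_deriv: "(\<psi> has_real_derivative 1 * \<phi> y + (- m) * K y) (at y)" for y
      unfolding \<psi>_def using DERIV_diff[OF oint_deriv[OF c\<phi>] DERIV_cmult[OF \<theta>_deriv]] by simp
    have sm_\<psi>: "smooth \<psi>"
      by (rule smooth_if_deriv[OF \<psi>_deriv]) (rule smooth_lincomb[OF sm K(1)])
    have d\<psi>: "deriv \<psi> y = \<phi> y - m * K y" for y
      using DERIV_imp_deriv[OF \<psi>_deriv] by simp
    have \<psi>_out: "\<psi> y = 0" if "1 \<le> \<bar>y\<bar>" for y
    proof (cases "0 \<le> y")
      case True
      then have y: "1 \<le> y" using that by simp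
      have "oint (-1) y \<phi> = oint (-1) 1 \<phi>"
        using outside[OF out y] oint_split[OF c\<phi>, of 1 y "-1"] by simp
      then show ?thesis using \<theta>_right[OF y] \<kappa> by (simp add: \<psi>_def m_def)
    next
      case False
      then have y: "y \<le> -1" using that by simp
      show ?thesis
        using outside[OF out y] oint_swap[OF c\<phi>, of "-1" y] \<theta>_left[OF y] by (simp add: \<psi>_def)
    qed
    have "supp \<psi> \<subseteq> {-1..1}"
      unfolding supp_def by (rule closure_minimal) (use \<psi>_out in \<open>force simp: abs_le_iff\<close>, simp)
    then have "compact (supp \<psi>)"
      by (metis supp_def closed_closure compact_Icc compact_Int_closed inf.absorb_iff2)
    then have "(LBINT x. f x * deriv \<psi> x) = - (LBINT x. g x * \<psi> x)"
      using weak sm_\<psi> unfolding weak_derivative_def test_function_def by blast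
    also have "\<dots> = (LBINT x. indicator {-1..1} x * deriv \<psi> x * ?G x)"
      using primitive_vs_test[OF g sm_\<psi> \<psi>_out] by simp
    finally have "(LBINT x. f x * deriv \<psi> x) = (LBINT x. indicator {-1..1} x * deriv \<psi> x * ?G x)" .
    moreover have "f x * deriv \<psi> x = indicator {-1..1} x * f x * deriv \<psi> x" for x
      using out[of x] K(3)[of x] by (cases "1 \<le> \<bar>x\<bar>") (auto simp: d\<psi> indicator_def)
    ultimately have "(LBINT x. indicator {-1..1} x * f x * deriv \<psi> x)
        = (LBINT x. indicator {-1..1} x * deriv \<psi> x * ?G x)" by simp
    moreover have "continuous_on UNIV (deriv \<psi>)"
      unfolding d\<psi>[abs_def] by (intro continuous_intros c\<phi> cK)
    note int1 = int_mult[OF this] 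
    have int2: "integrable lborel (\<lambda>x. indicator {-1..1} x * deriv \<psi> x * ?G x)"
      using int_ind(1)[of "\<lambda>x. deriv \<psi> x * ?G x"] \<open>continuous_on UNIV (deriv \<psi>)\<close>
      by (simp add: mult.assoc continuous_on_mult cG)
    have "(LBINT x. indicator {-1..1} x * f x * deriv \<psi> x)
        = (LBINT x. E x * deriv \<psi> x + indicator {-1..1} x * deriv \<psi> x * ?G x)"
      by (intro Bochner_Integration.integral_cong) (auto simp: E_def algebra_simps)
    ultimately have "(LBINT x. E x * deriv \<psi> x) = 0"
      using Bochner_Integration.integral_add[OF int1 int2] by simp
    moreover have "E x * deriv \<psi> x = E x * \<phi> x - m * (E x * K x)" for x
      by (simp add: d\<psi> algebra_simps)
    ultimately have "(LBINT x. E x * \<phi> x) - m * (LBINT x. E x * K x) = 0"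
      using int_mult[OF c\<phi>] int_mult[OF cK] by simp
    then have "(LBINT x. E x * \<phi> x) = c * oint (-1) 1 \<phi>"
      using \<kappa> by (simp add: m_def c_def field_simps)
    moreover have "D x * \<phi> x = E x * \<phi> x - c * (indicator {-1..1} x * \<phi> x)" for x
      by (simp add: D_def algebra_simps)
    ultimately show ?thesis
      using int_mult[OF c\<phi>] int_ind[OF c\<phi>] by simp
  qed
  have interval: "(LBINT x. D x * (\<kappa> * indicator {-1<..<b} x)) = 0" if b: "-1 < b" "b \<le> 1" for b
  proof -
    \<comment> \<open>The shifts by \<open>1\<close> keep the support of \<open>\<phi> n\<close> inside \<open>[-1, b]\<close> once \<open>n\<close> is large.\<close>
    define \<phi> where "\<phi> n y = \<theta> (real n * (y + 1) - 1) - \<theta> (real n * (y - b) + 1)" for n :: nat and y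
    have sm: "smooth (\<phi> n)" for n
    proof -
      have "\<phi> n = (\<lambda>y. 1 * \<theta> (real n * y + (real n - 1)) + (- 1) * \<theta> (real n * y + (1 - real n * b)))"
        by (auto simp: \<phi>_def fun_eq_iff algebra_simps)
      then show ?thesis
        using smooth_lincomb[OF smooth_affine[OF sm_\<theta>] smooth_affine[OF sm_\<theta>]] by metis
    qed
    have large: "\<forall>\<^sub>F n in sequentially. 2 \<le> real n * d" if "0 < d" for d
    proof -
      obtain N where "2 / d < real N" using reals_Archimedean2 by blast
      then have "2 \<le> real n * d" if "N \<le> n" for n
        using \<open>0 < d\<close> that by (simp add: field_simps) (smt (verit) mult_left_mono of_nat_mono)
      then show ?thesis by (auto simp: eventually_sequentially)
    qed
    have \<phi>_out: "\<phi> n y = 0" if n: "2 \<le> real n * (b + 1)" and y: "y \<le> -1 \<or> b \<le> y" for n y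
      using y
    proof
      assume "y \<le> -1"
      then have "real n * (y + 1) \<le> 0" "real n * (y - b) \<le> real n * (- 1 - b)"
        by (auto intro!: mult_nonneg_nonpos mult_left_mono)
      then show ?thesis using n by (simp add: \<phi>_def \<theta>_left algebra_simps)
    next
      assume "b \<le> y"
      then have "real n * (b + 1) \<le> real n * (y + 1)" "0 \<le> real n * (y - b)"
        by (auto intro!: mult_left_mono)
      then show ?thesis using n by (simp add: \<phi>_def \<theta>_right)
    qed
    have lim: "(\<lambda>n. D y * \<phi> n y) \<longlonglongrightarrow> D y * (\<kappa> * indicator {-1<..<b} y)" for y
    proof (rule tendsto_eventually, cases "-1 < y \<and> y < b")
      case True
      then have "\<forall>\<^sub>F n in sequentially. 2 \<le> real n * (y + 1)" "\<forall>\<^sub>F n in sequentially. 2 \<le> real n * (b - y)"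
        by (auto intro!: large)
      then show "\<forall>\<^sub>F n in sequentially. D y * \<phi> n y = D y * (\<kappa> * indicator {-1<..<b} y)"
      proof eventually_elim
        case (elim n)
        then have "1 \<le> real n * (y + 1) - 1" "real n * (y - b) + 1 \<le> -1"
          by (auto simp: algebra_simps)
        then show ?case using True by (simp add: \<phi>_def \<theta>_left \<theta>_right)
      qed
    next
      case False
      have "\<forall>\<^sub>F n in sequentially. 2 \<le> real n * (b + 1)" using b by (intro large) auto
      then show "\<forall>\<^sub>F n in sequentially. D y * \<phi> n y = D y * (\<kappa> * indicator {-1<..<b} y)"
        by eventually_elim (use False \<phi>_out[of _ y] in \<open>auto simp: not_less\<close>)
    qed
    have [measurable]: "\<phi> n \<in> borel_measurable borel" "D \<in> borel_measurable borel" for n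
      using smooth_continuous[OF sm] borel_measurable_continuous_onI D by auto
    have "(\<lambda>n. LBINT y. D y * \<phi> n y) \<longlonglongrightarrow> (LBINT y. D y * (\<kappa> * indicator {-1<..<b} y))"
    proof (rule integral_dominated_convergence[where w = "\<lambda>y. \<kappa> * \<bar>D y\<bar>"])
      have "\<bar>\<phi> n y\<bar> \<le> \<kappa>" for n y
        using \<theta>_range[of "real n * (y + 1) - 1"] \<theta>_range[of "real n * (y - b) + 1"]
        unfolding \<phi>_def by linarith
      then show "AE y in lborel. norm (D y * \<phi> n y) \<le> \<kappa> * \<bar>D y\<bar>" for n
        by (intro AE_I2) (metis abs_ge_zero abs_mult mult.commute mult_right_mono real_norm_def)
    qed (use lim D in auto)
    moreover have "(\<lambda>n. LBINT y. D y * \<phi> n y) \<longlonglongrightarrow> 0"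
    proof (rule tendsto_eventually)
      have "\<forall>\<^sub>F n in sequentially. 2 \<le> real n * (b + 1)" using b by (intro large) auto
      then show "\<forall>\<^sub>F n in sequentially. (LBINT y. D y * \<phi> n y) = 0"
        by eventually_elim (rule test[OF sm \<phi>_out], use b in auto)
    qed
    ultimately show ?thesis using LIMSEQ_unique by blast
  qed
  define D1 where "D1 x = D x * indicator {-1<..<1} x" for x
  have "AE x in lborel. D1 x = 0"
  proof (rule AE_zero_if_halfline_integrals_zero)
    show "integrable lborel D1"
      using integrable_mult_indicator[OF _ D, of "{-1<..<1}"]
      by (simp add: D1_def[abs_def] mult.commute)
    fix a
    show "(LBINT x:{..a}. D1 x) = 0"
    proof (cases "-1 < a")
      case True
      have "(LBINT x. D x * (\<kappa> * indicator {-1<..<min a 1} x)) = (LBINT x. \<kappa> * (indicator {..a} x *\<^sub>R D1 x))"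
        by (rule integral_cong_AE) (use AE_lborel_singleton[of a] D in \<open>auto simp: D1_def indicator_def elim!: AE_mp\<close>)
      also have "\<dots> = \<kappa> * (LBINT x:{..a}. D1 x)"
        by (simp add: set_lebesgue_integral_def)
      finally show ?thesis using interval[of "min a 1"] True \<kappa> by auto
    next
      case False
      then have "(\<lambda>x. indicator {..a} x *\<^sub>R D1 x) = (\<lambda>_. 0)"
        by (intro ext) (auto simp: D1_def indicator_def)
      then show ?thesis by (simp add: set_lebesgue_integral_def)
    qed
  qed
  then have "AE x in lborel. -1 < x \<and> x < 1 \<longrightarrow> f x = c + ?G x"
    by eventually_elim (auto simp: D1_def D_def E_def)
  then show ?thesis by (rule that)
qed

section \<open>Sobolev embedding on an interval\<close>

lemma AE_interval_imp_all:
  fixes P :: "real \<Rightarrow> bool"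
  assumes AE: "AE x in lborel. a < x \<and> x < b \<longrightarrow> P x" and closed: "closed {x. P x}"
    and "a < b" "x \<in> {a..b}"
  shows "P x"
proof (rule ccontr)
  assume "\<not> P x"
  have "x \<in> closure {a<..<b}" using assms(3,4) by simp
  then have "- {x. P x} \<inter> {a<..<b} \<noteq> {}"
    using open_Int_closure_eq_empty[of "- {x. P x}" "{a<..<b}"] closed \<open>\<not> P x\<close> by auto
  then obtain z where z: "z \<in> - {x. P x} \<inter> {a<..<b}" by blast
  moreover have "open (- {x. P x} \<inter> {a<..<b})" using closed by auto
  ultimately obtain e where e: "0 < e" "ball z e \<subseteq> - {x. P x} \<inter> {a<..<b}"
    by (meson openE)
  have "AE x in lborel. x \<notin> ball z e"
    using AE by eventually_elim (use e(2) in auto)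
  then have "ball z e \<in> null_sets lborel"
    by (subst AE_iff_null_sets) auto
  then have "emeasure lborel {z - e<..<z + e} = 0"
    by (simp add: ball_eq_greaterThanLessThan null_sets_def)
  then show False using e(1) by simp
qed

lemma L2_mult_integrable:
  assumes "f \<in> L2" "g \<in> L2"
  shows "integrable lborel (\<lambda>x. f x * g x)"
proof (rule Bochner_Integration.integrable_bound)
  show "integrable lborel (\<lambda>x. (f x)\<^sup>2 + (g x)\<^sup>2)"
    using assms by (intro Bochner_Integration.integrable_add) (auto simp: L2_def)
  show "(\<lambda>x. f x * g x) \<in> borel_measurable lborel"
    using assms by (auto simp: L2_def)
  have "\<bar>f x * g x\<bar> \<le> (f x)\<^sup>2 + (g x)\<^sup>2" for x
  proof -
    have "0 \<le> (\<bar>f x\<bar> - \<bar>g x\<bar>)\<^sup>2" by simp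
    then have "2 * \<bar>f x * g x\<bar> \<le> (f x)\<^sup>2 + (g x)\<^sup>2" by (simp add: power2_diff abs_mult)
    then show ?thesis using abs_ge_zero[of "f x * g x"] by linarith
  qed
  then show "AE x in lborel. norm (f x * g x) \<le> norm ((f x)\<^sup>2 + (g x)\<^sup>2)"
    by auto
qed

lemma L2_diff:
  assumes f: "f \<in> L2" and g: "g \<in> L2"
  shows "(\<lambda>x. f x - g x) \<in> L2"
proof -
  have "integrable lborel (\<lambda>x. (f x)\<^sup>2 + (g x)\<^sup>2 - 2 * (f x * g x))"
    using f g L2_mult_integrable[OF f g] by (auto simp: L2_def)
  then show ?thesis
    using f g by (auto simp: L2_def power2_diff mult.assoc)
qed

lemma L2_norm_squared: "(L2_norm f)\<^sup>2 = (LBINT x. (f x)\<^sup>2)"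
  by (simp add: L2_norm_def)

lemma L2_if_continuous_compact_support:
  assumes f: "continuous_on UNIV f" and S: "compact S" and out: "\<And>x. x \<notin> S \<Longrightarrow> f x = 0"
  shows "f \<in> L2"
proof -
  have "set_integrable lborel S (\<lambda>x. (f x)\<^sup>2)"
    unfolding set_integrable_def
    by (rule borel_integrable_compact[OF S])
      (intro continuous_intros continuous_on_subset[OF f] subset_UNIV)
  moreover have "(\<lambda>x. indicator S x *\<^sub>R (f x)\<^sup>2) = (\<lambda>x. (f x)\<^sup>2)"
    by (rule ext) (use out in \<open>auto simp: indicator_def\<close>)
  ultimately show ?thesis
    using f by (auto simp: L2_def set_integrable_def intro: borel_measurable_continuous_onI)
qed

lemma test_function_L2:
  assumes "test_function \<phi>"
  shows "\<phi> \<in> L2" "deriv \<phi> \<in> L2"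
proof -
  have sm: "smooth \<phi>" and S: "compact (supp \<phi>)"
    using assms by (auto simp: test_function_def)
  have out: "\<phi> x = 0" if "x \<notin> supp \<phi>" for x
    using that closure_subset[of "{x. \<phi> x \<noteq> 0}"] by (auto simp: supp_def)
  have "deriv \<phi> x = 0" if "x \<notin> supp \<phi>" for x
  proof -
    have "open (- supp \<phi>)" by (simp add: supp_def open_Compl)
    then have "(\<phi> has_real_derivative 0) (at x)"
      by (rule has_field_derivative_transform_within_open[OF DERIV_const]) (use that out in auto)
    then show ?thesis by (rule DERIV_imp_deriv)
  qed
  moreover have "continuous_on UNIV (deriv \<phi>)"
    using sm smooth_iff[of \<phi>] smooth_continuous by auto
  ultimately show "deriv \<phi> \<in> L2" by (intro L2_if_continuous_compact_support[OF _ S])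
  show "\<phi> \<in> L2" by (rule L2_if_continuous_compact_support[OF smooth_continuous[OF sm] S out])
qed

lemma weak_derivative_diff:
  assumes L2: "f1 \<in> L2" "f2 \<in> L2" "g1 \<in> L2" "g2 \<in> L2"
    and weak: "weak_derivative f1 g1" "weak_derivative f2 g2"
  shows "weak_derivative (\<lambda>x. f1 x - f2 x) (\<lambda>x. g1 x - g2 x)"
  unfolding weak_derivative_def
proof (intro allI impI)
  fix \<phi> assume \<phi>: "test_function \<phi>"
  note int = L2_mult_integrable[OF L2(1) test_function_L2(2)[OF \<phi>]] L2_mult_integrable[OF L2(2) test_function_L2(2)[OF \<phi>]]
    L2_mult_integrable[OF L2(3) test_function_L2(1)[OF \<phi>]] L2_mult_integrable[OF L2(4) test_function_L2(1)[OF \<phi>]]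
  have "(LBINT x. f1 x * deriv \<phi> x) = - (LBINT x. g1 x * \<phi> x)"
    "(LBINT x. f2 x * deriv \<phi> x) = - (LBINT x. g2 x * \<phi> x)"
    using weak \<phi> by (auto simp: weak_derivative_def)
  then show "(LBINT x. (f1 x - f2 x) * deriv \<phi> x) = - (LBINT x. (g1 x - g2 x) * \<phi> x)"
    using int by (simp add: left_diff_distrib)
qed

lemma H1_diff:
  assumes "f \<in> H1" "g \<in> H1"
  shows "(\<lambda>x. f x - g x) \<in> H1"
proof -
  obtain f' g' where "f' \<in> L2" "weak_derivative f f'" "g' \<in> L2" "weak_derivative g g'"
    using assms by (auto simp: H1_def)
  moreover have "f \<in> L2" "g \<in> L2" using assms by (auto simp: H1_def)
  ultimately show ?thesis
    unfolding H1_def using L2_diff weak_derivative_diff by blast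
qed

lemma abs_le_eps_plus_square:
  fixes a \<epsilon> :: real
  assumes "0 < \<epsilon>"
  shows "\<bar>a\<bar> \<le> \<epsilon> + a\<^sup>2 / \<epsilon>"
proof -
  have "0 \<le> (\<bar>a\<bar> - \<epsilon>)\<^sup>2" by simp
  then have "2 * (\<bar>a\<bar> * \<epsilon>) \<le> \<epsilon>\<^sup>2 + a\<^sup>2" by (simp add: power2_diff)
  moreover have "0 \<le> \<bar>a\<bar> * \<epsilon>" using assms by simp
  ultimately have "\<bar>a\<bar> * \<epsilon> \<le> \<epsilon>\<^sup>2 + a\<^sup>2" by linarith
  then show ?thesis using assms by (simp add: field_simps power2_eq_square)
qed

text \<open>
  The Sobolev embedding on \<open>(-1, 1)\<close>. The bound with a free \<open>\<epsilon>\<close> avoids square roots;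
  it makes the representative small when the norm is.
\<close>

lemma H1_continuous_representative:
  assumes K: "admissible K" and f: "f \<in> H1"
  obtains h where "continuous_on UNIV h" "AE x in lborel. -1 < x \<and> x < 1 \<longrightarrow> f x = h x"
    "\<And>x \<epsilon>. 0 < \<epsilon> \<Longrightarrow> \<bar>h x\<bar> \<le> 3 * \<epsilon> + (H1_norm f)\<^sup>2 / \<epsilon>"
proof -
  define g where "g = (SOME g. g \<in> L2 \<and> weak_derivative f g)"
  have "\<exists>g. g \<in> L2 \<and> weak_derivative f g" using f by (auto simp: H1_def)
  from someI_ex[OF this] have g: "g \<in> L2" and weak: "weak_derivative f g" by (auto simp: g_def)
  have f2: "f \<in> L2" using f by (simp add: H1_def)
  obtain c where c: "AE x in lborel. -1 < x \<and> x < 1 \<longrightarrow> f x = c + local_primitive g x"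
    by (rule weak_derivative_primitive[OF K f2 g weak])
  define A where "A = (LBINT x. (f x)\<^sup>2)"
  define B where "B = (LBINT x. (g x)\<^sup>2)"
  have A: "0 \<le> A" and B: "0 \<le> B" by (auto simp: A_def B_def)
  have H: "(H1_norm f)\<^sup>2 = A + B"
    unfolding H1_norm_def g_def[symmetric] L2_norm_squared using A B by (simp add: A_def B_def)
  have int: "integrable lborel (\<lambda>x. (f x)\<^sup>2)" "integrable lborel (\<lambda>x. (g x)\<^sup>2)"
    using f2 g by (auto simp: L2_def)
  show ?thesis
  proof (rule that[of "\<lambda>x. c + local_primitive g x"])
    show "continuous_on UNIV (\<lambda>x. c + local_primitive g x)"
      by (intro continuous_intros continuous_local_primitive[OF g])
    show "AE x in lborel. -1 < x \<and> x < 1 \<longrightarrow> f x = c + local_primitive g x" by (rule c)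
    fix x \<epsilon> :: real assume \<epsilon>: "0 < \<epsilon>"
    define M where "M = 2 * \<epsilon> + B / \<epsilon>"
    have osc: "\<bar>local_primitive g y - local_primitive g x\<bar> \<le> M" if "x \<le> y" for x y
    proof -
      have "\<bar>LBINT z:{x<..y}. indicator {-1..1} z * g z\<bar> \<le> (LBINT z. \<epsilon> * indicator {-1..1} z + (g z)\<^sup>2 / \<epsilon>)"
        unfolding set_lebesgue_integral_def
      proof (rule integral_abs_bound_integral)
        show "integrable lborel (\<lambda>z. indicator {x<..y} z *\<^sub>R (indicator {-1..1} z * g z))"
          by (rule integrable_mult_indicator[OF _ L2_set_integrable[OF g]]) simp
        show "integrable lborel (\<lambda>z. \<epsilon> * indicator {-1..1} z + (g z)\<^sup>2 / \<epsilon>)"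
          using int by (intro Bochner_Integration.integrable_add) auto
        show "\<bar>indicator {x<..y} z *\<^sub>R (indicator {-1..1} z * g z)\<bar> \<le> \<epsilon> * indicator {-1..1} z + (g z)\<^sup>2 / \<epsilon>" for z
          using abs_le_eps_plus_square[OF \<epsilon>, of "g z"] \<epsilon> by (auto simp: indicator_def)
      qed
      also have "\<dots> = M"
        using int by (simp add: M_def B_def)
      finally show ?thesis using local_primitive_diff[OF g that] by simp
    qed
    \<comment> \<open>Integrating this bound over \<open>z \<in> (-1, 1)\<close> compares the value at \<open>x\<close> with the mean.\<close>
    have osc: "\<bar>c + local_primitive g x\<bar> \<le> \<bar>c + local_primitive g z\<bar> + M" for z
      using osc[of x z] osc[of z x] by (cases "x \<le> z") auto
    let ?h = "c + local_primitive g x"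
    have "(LBINT z. \<bar>?h\<bar> * indicator {-1<..<1::real} z) \<le> (LBINT z. (\<epsilon> + M) * indicator {-1..1} z + (f z)\<^sup>2 / \<epsilon>)"
    proof (rule integral_mono_AE)
      show "integrable lborel (\<lambda>z. \<bar>?h\<bar> * indicator {-1<..<1::real} z)" by simp
      show "integrable lborel (\<lambda>z. (\<epsilon> + M) * indicator {-1..1} z + (f z)\<^sup>2 / \<epsilon>)"
        using int by (intro Bochner_Integration.integrable_add) auto
      have M: "0 \<le> M" using B \<epsilon> by (simp add: M_def)
      show "AE z in lborel. \<bar>?h\<bar> * indicator {-1<..<1} z \<le> (\<epsilon> + M) * indicator {-1..1} z + (f z)\<^sup>2 / \<epsilon>"
        using c
      proof eventually_elim
        case (elim z)
        show ?case
          using osc[of z] abs_le_eps_plus_square[OF \<epsilon>, of "f z"] elim \<epsilon> M by (auto simp: indicator_def)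
      qed
    qed
    then have "2 * \<bar>?h\<bar> \<le> 2 * (\<epsilon> + M) + A / \<epsilon>"
      using int by (simp add: A_def)
    moreover have "0 \<le> A / \<epsilon>" using A \<epsilon> by simp
    ultimately show "\<bar>?h\<bar> \<le> 3 * \<epsilon> + (H1_norm f)\<^sup>2 / \<epsilon>"
      unfolding H M_def by (simp add: add_divide_distrib)
  qed
qed

text \<open>
  A continuous path in \<open>H\<^sup>1\<close> is represented on \<open>(-1, 1)\<close> by a jointly continuous function. The
  representatives on \<open>[-1, 1]\<close> are extended to the line as constants on either side.
\<close>

lemma H1_path_representative:
  assumes K: "admissible K" and u: "continuous_H1 u"
  obtains w where "continuous_on UNIV (\<lambda>(t, x). w t x)"
    "\<And>t. AE x in lborel. -1 < x \<and> x < 1 \<longrightarrow> u t x = w t x"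
proof -
  have H1: "u t \<in> H1" for t using u by (simp add: continuous_H1_def)
  have "\<exists>h. continuous_on UNIV h \<and> (AE x in lborel. -1 < x \<and> x < 1 \<longrightarrow> u t x = h x)" for t
    using H1_continuous_representative[OF K H1] by metis
  then obtain W where W: "\<And>t. continuous_on UNIV (W t)"
    "\<And>t. AE x in lborel. -1 < x \<and> x < 1 \<longrightarrow> u t x = W t x"
    by metis
  have bound: "\<bar>W s x - W t x\<bar> \<le> 3 * \<epsilon> + (H1_norm (\<lambda>x. u s x - u t x))\<^sup>2 / \<epsilon>"
    if "0 < \<epsilon>" "x \<in> {-1..1}" for s t x \<epsilon>
  proof -
    obtain h where h: "continuous_on UNIV h"
      "AE x in lborel. -1 < x \<and> x < 1 \<longrightarrow> u s x - u t x = h x"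
      "\<And>x \<epsilon>. 0 < \<epsilon> \<Longrightarrow> \<bar>h x\<bar> \<le> 3 * \<epsilon> + (H1_norm (\<lambda>x. u s x - u t x))\<^sup>2 / \<epsilon>"
      by (rule H1_continuous_representative[OF K H1_diff[OF H1[of s] H1[of t]]]) blast
    have "AE x in lborel. -1 < x \<and> x < 1 \<longrightarrow> W s x - W t x = h x"
      using W(2)[of s] W(2)[of t] h(2) by eventually_elim auto
    then have "W s x - W t x = h x"
      by (rule AE_interval_imp_all) (use that in \<open>auto intro!: closed_Collect_eq continuous_intros W h\<close>)
    then show ?thesis using h(3)[OF that(1)] by simp
  qed
  have uniform: "\<forall>\<^sub>F s in nhds t. \<forall>x\<in>{-1..1}. \<bar>W s x - W t x\<bar> \<le> \<eta>" if "0 < \<eta>" for t \<eta>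
  proof -
    have "((\<lambda>s. (H1_norm (\<lambda>x. u s x - u t x))\<^sup>2 / (\<eta> / 6)) \<longlongrightarrow> 0\<^sup>2 / (\<eta> / 6)) (at t)"
      using u that by (intro tendsto_intros) (auto simp: continuous_H1_def)
    then have "\<forall>\<^sub>F s in at t. (H1_norm (\<lambda>x. u s x - u t x))\<^sup>2 / (\<eta> / 6) < \<eta> / 2"
      by (rule order_tendstoD(2)) (use that in simp)
    then have "\<forall>\<^sub>F s in at t. \<forall>x\<in>{-1..1}. \<bar>W s x - W t x\<bar> \<le> \<eta>"
    proof eventually_elim
      case (elim s)
      then show ?case using bound[of "\<eta> / 6" _ s t] that by force
    qed
    then show ?thesis
      unfolding eventually_at_filter by eventually_elim (use that in auto)
  qed
  define w where "w t x = W t (max (-1) (min 1 x))" for t x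
  show ?thesis
  proof (rule that[of w])
    have "((\<lambda>z. w (fst z) (snd z)) \<longlongrightarrow> w t x) (at (t, x))" for t x
    proof -
      let ?c = "\<lambda>x :: real. max (-1) (min 1 x)"
      have 1: "((\<lambda>z. W t (?c (snd z))) \<longlongrightarrow> W t (?c x)) (at (t, x))"
      proof -
        have "isCont (\<lambda>z. W t (?c (snd z))) (t, x)"
          by (intro continuous_on_interior[of UNIV] continuous_on_compose2[OF W(1)] continuous_intros) auto
        then show ?thesis by (simp add: isCont_def)
      qed
      have 2: "((\<lambda>z. W (fst z) (?c (snd z)) - W t (?c (snd z))) \<longlongrightarrow> 0) (at (t, x))"
        unfolding tendsto_iff dist_real_def
      proof (intro allI impI)
        fix e :: real assume "0 < e"
        have "filterlim fst (nhds t) (at (t, x))"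
          using tendsto_fst[OF tendsto_ident_at, of "(t, x)" UNIV] by simp
        then have "\<forall>\<^sub>F z in at (t, x). \<forall>x\<in>{-1..1}. \<bar>W (fst z) x - W t x\<bar> \<le> e / 2"
          using uniform[of "e / 2" t] \<open>0 < e\<close> by (auto simp: filterlim_iff)
        then show "\<forall>\<^sub>F z in at (t, x). \<bar>W (fst z) (?c (snd z)) - W t (?c (snd z)) - 0\<bar> < e"
        proof eventually_elim
          case (elim z)
          then have "\<bar>W (fst z) (?c (snd z)) - W t (?c (snd z))\<bar> \<le> e / 2" by auto
          then show ?case using \<open>0 < e\<close> by simp
        qed
      qed
      show ?thesis using tendsto_add[OF 1 2] by (simp add: w_def)
    qed
    from this[of "fst a" "snd a" for a] show "continuous_on UNIV (\<lambda>(t, x). w t x)"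
      unfolding split_beta by (intro continuous_at_imp_continuous_on) (simp add: isCont_def)
    show "AE x in lborel. -1 < x \<and> x < 1 \<longrightarrow> u t x = w t x" for t
      using W(2)[of t] by eventually_elim (auto simp: w_def)
  qed
qed

section \<open>From the integral equation to the decay\<close>

text \<open>
  The union in the definition of the support is uncountable; by the Lindelof property countably
  many of the open sets suffice.
\<close>

lemma AE_zero_outside_ess_supp: "AE x in lborel. x \<notin> ess_supp f \<longrightarrow> f x = 0"
proof -
  define \<U> where "\<U> = {U. open U \<and> (AE x in lborel. x \<in> U \<longrightarrow> f x = 0)}"
  obtain \<V> where \<V>: "\<V> \<subseteq> \<U>" "countable \<V>" "\<Union>\<V> = \<Union>\<U>"
    by (rule Lindelof[of \<U>]) (auto simp: \<U>_def)
  have "AE x in lborel. \<forall>U\<in>\<V>. x \<in> U \<longrightarrow> f x = 0"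
    using \<V>(1,2) by (subst AE_ball_countable) (auto simp: \<U>_def)
  then show ?thesis
    by eventually_elim (use \<V>(3) in \<open>auto simp: ess_supp_def \<U>_def[symmetric]\<close>)
qed

text \<open>
  Inside the forward light cone left behind by the data the linear wave is constant.
\<close>

lemma linear_wave_late:
  assumes u0: "u0 \<in> H1" and u1: "u1 \<in> L2"
    and supp: "ess_supp (\<lambda>x. (u0 x, u1 x)) \<subseteq> {-R0..R0}" and t: "0 \<le> t"
  shows "AE x in lborel. \<bar>x\<bar> < t - R0 \<longrightarrow> linear_wave u0 u1 t x = (LBINT s:{-R0..R0}. u1 s) / 2"
proof -
  have [measurable]: "u0 \<in> borel_measurable borel" "u1 \<in> borel_measurable borel"
    using u0 u1 by (auto simp: H1_def L2_def)
  have AE: "AE x in lborel. x \<notin> {-R0..R0} \<longrightarrow> u0 x = 0 \<and> u1 x = 0"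
    using AE_zero_outside_ess_supp[of "\<lambda>x. (u0 x, u1 x)"]
    by eventually_elim (use supp in \<open>auto simp: zero_prod_def\<close>)
  have m: "Measurable.pred borel (\<lambda>x. x \<notin> {-R0..R0} \<longrightarrow> u0 x = 0 \<and> u1 x = 0)"
    by measurable
  have shifted: "AE x in lborel. d + 1 * x \<notin> {-R0..R0} \<longrightarrow> u0 (d + 1 * x) = 0 \<and> u1 (d + 1 * x) = 0" for d
    by (rule AE_borel_affine[OF _ m AE]) simp
  have u1_int: "(LBINT s=ereal (x - t)..ereal (x + t). u1 s) = (LBINT s:{-R0..R0}. u1 s)"
    if "\<bar>x\<bar> < t - R0" for x
  proof -
    have "(LBINT s=ereal (x - t)..ereal (x + t). u1 s) = (LBINT s:{x - t<..<x + t}. u1 s)"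
      using t by (simp add: interval_lebesgue_integral_le_eq)
    also have "\<dots> = (LBINT s:{-R0..R0}. u1 s)"
      unfolding set_lebesgue_integral_def
    proof (rule integral_cong_AE)
      show "AE s in lborel. indicator {x - t<..<x + t} s *\<^sub>R u1 s = indicator {-R0..R0} s *\<^sub>R u1 s"
        using AE by eventually_elim (use that in \<open>auto simp: indicator_def\<close>)
    qed measurable
    finally show ?thesis .
  qed
  show ?thesis
    using shifted[of t] shifted[of "- t"]
  proof eventually_elim
    case (elim x)
    show ?case
    proof
      assume x: "\<bar>x\<bar> < t - R0"
      show "linear_wave u0 u1 t x = (LBINT s:{-R0..R0}. u1 s) / 2"
      proof -
        have "u0 (x + t) = 0" "u0 (x - t) = 0"
          using elim x t by (auto simp: add.commute)
        then show ?thesis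
          using u1_int[OF x] by (simp add: linear_wave_def)
      qed
    qed
  qed
qed

text \<open>
  The nonlinear term of the integral equation involves \<open>u\<close> on \<open>[-1, 1]\<close> only, so \<open>u\<close> may be
  replaced there by its continuous representative.
\<close>

lemma cone_integral_eq_oint:
  assumes K: "admissible K" and u: "\<And>s. u s \<in> borel_measurable borel"
    and w: "continuous_on UNIV (\<lambda>(t, x). w t x)"
    and uw: "\<And>s. AE y in lborel. -1 < y \<and> y < 1 \<longrightarrow> u s y = w s y"
    and t: "0 \<le> t"
  shows "(LBINT s=ereal 0..ereal t. (LBINT y=ereal (x - (t - s))..ereal (x + (t - s)). K y * u s y ^ 3))
    = oint 0 t (\<lambda>s. oint (x - (t - s)) (x + (t - s)) (\<lambda>y. K y * w s y ^ 3))"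
proof -
  note K = admissible_facts[OF K]
  have cK: "continuous_on A K" for A by (rule smooth_continuous[OF K(1)])
  have cF: "continuous_on UNIV (\<lambda>(s, y). K y * w s y ^ 3)"
    unfolding split_beta
    by (intro continuous_intros continuous_on_compose2[OF cK] continuous_on_comp2[OF w]) auto
  have cF1: "continuous_on A (\<lambda>y. K y * w s y ^ 3)" for s A
    by (intro continuous_intros cK continuous_on_comp2[OF w])
  have [measurable]: "u s \<in> borel_measurable borel" "K \<in> borel_measurable borel"
    "(\<lambda>y. K y * w s y ^ 3) \<in> borel_measurable borel" for s
    using u cK cF1 by (auto intro: borel_measurable_continuous_onI)
  have LBINT: "(LBINT y=ereal a..ereal b. f y) = oint a b f"
    if "a \<le> b" "continuous_on UNIV f" for a b f
    using that oint_eq_set_integral[of a b f]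
    by (simp add: interval_integral_Icc continuous_on_subset)
  have inner: "(LBINT y=ereal a..ereal b. K y * u s y ^ 3) = oint a b (\<lambda>y. K y * w s y ^ 3)"
    if "a \<le> b" for a b s
  proof -
    have "(LBINT y=ereal a..ereal b. K y * u s y ^ 3) = (LBINT y=ereal a..ereal b. K y * w s y ^ 3)"
    proof (rule interval_integral_cong_AE)
      show "AE y\<in>einterval (min (ereal a) (ereal b)) (max (ereal a) (ereal b)) in lborel.
          K y * u s y ^ 3 = K y * w s y ^ 3"
        using uw[of s]
      proof eventually_elim
        case (elim y)
        then show ?case using K(3)[of y] by (cases "1 \<le> \<bar>y\<bar>") auto
      qed
    qed measurable
    then show ?thesis using LBINT[OF that cF1] by simp
  qed
  have "(LBINT s=ereal 0..ereal t. (LBINT y=ereal (x - (t - s))..ereal (x + (t - s)). K y * u s y ^ 3))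
    = (LBINT s=ereal 0..ereal t. oint (x - (t - s)) (x + (t - s)) (\<lambda>y. K y * w s y ^ 3))"
    by (rule interval_integral_cong) (use t in \<open>auto simp: einterval_iff intro!: inner\<close>)
  also have "\<dots> = oint 0 t (\<lambda>s. oint (x - (t - s)) (x + (t - s)) (\<lambda>y. K y * w s y ^ 3))"
    by (rule LBINT[OF t]) (intro continuous_on_oint cF continuous_intros)
  finally show ?thesis .
qed

theorem theoremA1:
  fixes R0 :: real and u0 u1 K :: "real \<Rightarrow> real" and u :: "real \<Rightarrow> real \<Rightarrow> real"
  assumes "R0 > 0"
    and "u0 \<in> H1" and "u1 \<in> L2"
    and "ess_supp (\<lambda>x. (u0 x, u1 x)) \<subseteq> {-R0..R0}"
    and "admissible K"
    and "global_solution K u0 u1 u"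
  shows "\<forall>R\<ge>1. ((\<lambda>t. Linf_norm {-R..R} (u t)) \<longlongrightarrow> 0) at_top"
proof -
  note K = admissible_facts[OF assms(5)]
  have cH1: "continuous_H1 u"
    and eq: "\<And>t. AE x in lborel. u t x = linear_wave u0 u1 t x -
      (LBINT s=ereal 0..ereal t.
        (LBINT y=ereal (x - (t - s))..ereal (x + (t - s)). K y * u s y ^ 3)) / 2"
    using assms(6) by (auto simp: global_solution_def)
  have u_meas [measurable]: "u s \<in> borel_measurable borel" for s
    using cH1 by (auto simp: continuous_H1_def H1_def L2_def)
  obtain w where w: "continuous_on UNIV (\<lambda>(t, x). w t x)"
    and uw: "\<And>t. AE x in lborel. -1 < x \<and> x < 1 \<longrightarrow> u t x = w t x"
    using H1_path_representative[OF assms(5) cH1] by metis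
  define F where "F s y = K y * w s y ^ 3" for s y
  define c where "c = (LBINT s:{-R0..R0}. u1 s) / 2"
  have cF: "continuous_on UNIV (\<lambda>(s, y). F s y)"
    unfolding F_def split_beta
    by (intro continuous_intros continuous_on_compose2[OF smooth_continuous[OF K(1)]]
        continuous_on_comp2[OF w]) auto
  interpret forced_wave F c
    by unfold_locales (use cF K(3) in \<open>auto simp: F_def\<close>)
  have uv: "AE x in lborel. \<bar>x\<bar> < t - R0 \<longrightarrow> u t x = v t x" if "0 \<le> t" for t
    using eq[of t] linear_wave_late[OF assms(2-4) that]
  proof eventually_elim
    case (elim x)
    then show ?case
      unfolding cone_integral_eq_oint[OF assms(5) u_meas w uw that]
      unfolding v_def by (simp add: c_def F_def[abs_def])
  qed
  have wv: "w t x = v t x" if t: "R0 + 1 < t" and x: "\<bar>x\<bar> \<le> 1" for t x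
  proof (rule AE_interval_imp_all[where a = "-1" and b = 1 and x = x])
    show "AE x in lborel. -1 < x \<and> x < 1 \<longrightarrow> w t x = v t x"
    proof -
      have "0 \<le> t" using t assms(1) by linarith
      from uw[of t] uv[OF this] show ?thesis by eventually_elim (use t in auto)
    qed
    show "closed {x. w t x = v t x}"
      by (intro closed_Collect_eq continuous_on_comp2[OF w] continuous_intros)
  qed (use x in auto)
  interpret defocusing_wave F c K "deriv K" "R0 + 1"
  proof unfold_locales
    show "continuous_on UNIV (deriv K)"
      using K(1) smooth_iff[of K] smooth_continuous by auto
  qed (use K smooth_has_deriv wv assms(1) in \<open>auto simp: F_def\<close>)
  show ?thesis
  proof (intro allI impI order_tendstoI)
    fix R :: real and e :: ennreal
    assume "0 < e"
    then obtain z where "0 < z" "z < e" using dense by blast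
    then obtain \<eta> where \<eta>: "0 < \<eta>" "ennreal \<eta> < e"
      by (cases z) auto
    obtain T where T: "\<And>t x. T \<le> t \<Longrightarrow> \<bar>x\<bar> \<le> R \<Longrightarrow> \<bar>v t x\<bar> \<le> \<eta>"
      using v_decay[OF \<eta>(1)] by metis
    show "\<forall>\<^sub>F t in at_top. Linf_norm {-R..R} (u t) < e"
      using eventually_ge_at_top[of T] eventually_gt_at_top[of "\<bar>R\<bar> + R0"]
    proof eventually_elim
      case (elim t)
      have "AE x in restrict_space lborel {-R..R}. ennreal \<bar>u t x\<bar> \<le> ennreal \<eta>"
      proof (subst AE_restrict_space_iff)
        have "0 \<le> t" using elim assms(1) by linarith
        from uv[OF this] show "AE x in lborel. x \<in> {-R..R} \<longrightarrow> ennreal \<bar>u t x\<bar> \<le> ennreal \<eta>"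
        proof eventually_elim
          case (elim x)
          then show ?case using T[OF \<open>T \<le> t\<close>, of x] \<open>\<bar>R\<bar> + R0 < t\<close>
            by (auto intro!: ennreal_leI)
        qed
      qed simp
      then have "Linf_norm {-R..R} (u t) \<le> ennreal \<eta>"
        unfolding Linf_norm_def by (intro esssup_I measurable_restrict_space1) measurable
      then show ?case using \<eta>(2) by (rule le_less_trans)
    qed
  qed simp
qed

end
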